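(* For every real number $\iota<2$ there exists a constant $C_{\iota}>0$, depending only on $\iota$, such that for every $n\in \mathbb{N}$ and every balanced projection $T\in \mathbb{M}_{2^{n}}$ with $\mathrm{ind}(T)=\iota$, $$\max_{j\in [n]}\|\mathbf{d}_{j}(T)\|^{2}_{L_{2}}\;\ge\; \frac{C_{\iota}\log(n)}{n}.$$
   Context: $n\ge 1$ is an integer, $[n]=\{1,\dots,n\}$. $\mathbb{M}_{2^n}=M_2(\mathbb{C})^{\otimes n}$ is the algebra of complex $2^n\times 2^n$ matrices with unit $\mathbf{1}$, equipped with the normalized trace $\mathrm{tr}$ (so $\mathrm{tr}(\mathbf{1})=1$). A projection is $T$ with $T^*=T=T^2$. $|T|=(T^*T)^{1/2}$, and for $1\le p<\infty$, $\|T\|_{L_p}=(\mathrm{tr}(|T|^p))^{1/p}$. The variance is $\mathrm{var}(T)=\mathrm{tr}(|T|^2)-|\mathrm{tr}(T)|^2$; a projection $T$ is called balanced if $\mathrm{var}(T)=\frac14$. The $j$-th partial derivative is the linear map $\mathbf{d}_j=\mathrm{id}^{\otimes(j-1)}\otimes D\otimes \mathrm{id}^{\otimes(n-j)}$ on $\mathbb{M}_{2^n}$, where $D:M_2(\mathbb{C})\to M_2(\mathbb{C})$ is $D(A)=A-\mathrm{tr}(A)\mathbf{1}_2$ ($\mathrm{tr}$ being the normalized trace on $M_2(\mathbb{C})$). The index of $T$ is $\mathrm{ind}(T)=\inf\{\alpha\ge 0:\ \|\mathbf{d}_{j}(T)\|^{\alpha}_{L_{1}}\le \|\mathbf{d}_{j}(T)\|^{2}_{L_{2}}\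 \text{for all } j\in[n]\}$. *)

theory Defs
  imports Complex_Main "Jordan_Normal_Form.Schur_Decomposition"
begin

text \<open>
  The algebra \<open>M_2(C)\<^sup>\<otimes>\<^sup>n\<close> is \<open>carrier_mat (2 ^ n) (2 ^ n)\<close> over \<open>complex\<close>; a tensor product of
  matrices is identified with its Kronecker product, the first factor being the most significant
  part of a (0-based) row or column index. \<open>mat_adjoint\<close> is the conjugate transpose.
\<close>

definition ntr :: "complex mat \<Rightarrow> complex" where
  "ntr A = (\<Sum>i<dim_row A. A $$ (i, i)) / of_nat (dim_row A)"

definition projection :: "complex mat \<Rightarrow> bool" where
  "projection T \<longleftrightarrow> square_mat T \<and> mat_adjoint T = T \<and> T * T = T"


subsection \<open>Powers of positive semidefinite matrices and Schatten norms\<close>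

text \<open>
  \<open>spectral_powr_rel A p B\<close> says that \<open>A\<close> has a spectral decomposition \<open>U diag(d) U\<^sup>*\<close> with \<open>U\<close>
  unitary and \<open>d \<ge> 0\<close>, and that \<open>B = U diag(d\<^sup>p) U\<^sup>*\<close>. By the spectral theorem such a
  decomposition exists for every positive semidefinite \<open>A\<close>; that \<open>B\<close> does not depend on its
  choice is shown below. \<open>psd_powr\<close> is meant for \<open>p > 0\<close> only (\<open>0 powr p = 0\<close>).
\<close>

definition spectral_powr_rel :: "complex mat \<Rightarrow> real \<Rightarrow> complex mat \<Rightarrow> bool" where
  "spectral_powr_rel A p B \<longleftrightarrow>
     (\<exists>n U d. U \<in> carrier_mat n n \<and> mat_adjoint U * U = 1\<^sub>m n \<and> (\<forall>i<n. 0 \<le> d i) \<and>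
        A = U * mat_diag n (\<lambda>i. complex_of_real (d i)) * mat_adjoint U \<and>
        B = U * mat_diag n (\<lambda>i. complex_of_real (d i powr p)) * mat_adjoint U)"

definition psd_powr :: "complex mat \<Rightarrow> real \<Rightarrow> complex mat" where
  "psd_powr A p = (THE B. spectral_powr_rel A p B)"

definition mat_abs :: "complex mat \<Rightarrow> complex mat" where
  "mat_abs T = psd_powr (mat_adjoint T * T) (1 / 2)"

definition lp_norm :: "real \<Rightarrow> complex mat \<Rightarrow> real" where
  "lp_norm p T = Re (ntr (psd_powr (mat_abs T) p)) powr (1 / p)"

definition variance :: "complex mat \<Rightarrow> real" where
  "variance T = Re (ntr (mat_abs T * mat_abs T)) - (cmod (ntr T))\<^sup>2"

definition balanced_projection :: "complex mat \<Rightarrow> bool" where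
  "balanced_projection T \<longleftrightarrow> projection T \<and> variance T = 1 / 4"

lemma mat_adjoint_carrier: "U \<in> carrier_mat n m \<Longrightarrow> mat_adjoint U \<in> carrier_mat m n"
  by (auto simp: mat_adjoint_def)

lemma spectral_powr_rel_unique:
  assumes "spectral_powr_rel A p B" and "spectral_powr_rel A p B'"
  shows "B = B'"
proof -
  from assms(1) obtain n U d where U: "U \<in> carrier_mat n n" "mat_adjoint U * U = 1\<^sub>m n"
    and A: "A = U * mat_diag n (\<lambda>i. complex_of_real (d i)) * mat_adjoint U"
    and B: "B = U * mat_diag n (\<lambda>i. complex_of_real (d i powr p)) * mat_adjoint U"
    unfolding spectral_powr_rel_def by blast
  from assms(2) obtain m V e where V: "V \<in> carrier_mat m m" "mat_adjoint V * V = 1\<^sub>m m"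
    and A': "A = V * mat_diag m (\<lambda>i. complex_of_real (e i)) * mat_adjoint V"
    and B': "B' = V * mat_diag m (\<lambda>i. complex_of_real (e i powr p)) * mat_adjoint V"
    unfolding spectral_powr_rel_def by blast
  have mn: "m = n"
    using arg_cong[OF A, of dim_row] arg_cong[OF A', of dim_row] U(1) V(1) by auto
  note V = V[unfolded mn]
  let ?U' = "mat_adjoint U" and ?V' = "mat_adjoint V"
  have U': "?U' \<in> carrier_mat n n" and V': "?V' \<in> carrier_mat n n"
    using U V mat_adjoint_carrier by auto
  have UU': "U * ?U' = 1\<^sub>m n" and VV': "V * ?V' = 1\<^sub>m n"
    using mat_mult_left_right_inverse[OF U' U(1) U(2)]
      mat_mult_left_right_inverse[OF V' V(1) V(2)] by auto
  have inter: "?V' * U * mat_diag n f = mat_diag n g * (?V' * U)"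
    if eq: "U * mat_diag n f * ?U' = V * mat_diag n g * ?V'" for f g :: "nat \<Rightarrow> complex"
  proof -
    have F: "mat_diag n f \<in> carrier_mat n n" and G: "mat_diag n g \<in> carrier_mat n n" by auto
    have "?V' * U * mat_diag n f = ?V' * (U * mat_diag n f * ?U') * U"
      using U V U' V' F by (simp add: right_mult_one_mat[of _ n n] assoc_mult_mat[of _ n n _ n _ n] mult_carrier_mat[of _ n n _ n])
    also have "\<dots> = ?V' * (V * mat_diag n g * ?V') * U" by (simp only: eq)
    also have "\<dots> = ?V' * V * (mat_diag n g * (?V' * U))"
      using U(1) V(1) U' V' G by (simp add: assoc_mult_mat[of _ n n _ n _ n] mult_carrier_mat[of _ n n _ n])
    also have "\<dots> = mat_diag n g * (?V' * U)"
      using U V U' V' G by (simp add: left_mult_one_mat[of _ n n] mult_carrier_mat[of _ n n _ n])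
    finally show ?thesis .
  qed
  define W where "W = ?V' * U"
  have W: "W \<in> carrier_mat n n" using U V' by (simp add: W_def)
  have de: "W * mat_diag n (\<lambda>i. complex_of_real (d i)) =
            mat_diag n (\<lambda>i. complex_of_real (e i)) * W"
    unfolding W_def by (rule inter) (use A A' mn in simp)
  have W_de: "W $$ (i, j) = 0 \<or> d j = e i" if "i < n" "j < n" for i j
    using arg_cong[OF de, of "\<lambda>M. M $$ (i, j)"] that W
    by (auto simp: mat_diag_mult_left[OF W] mat_diag_mult_right[OF W])
  have pw: "W * mat_diag n (\<lambda>i. complex_of_real (d i powr p)) =
            mat_diag n (\<lambda>i. complex_of_real (e i powr p)) * W"
    unfolding mat_diag_mult_left[OF W] mat_diag_mult_right[OF W]
    using W_de by (intro eq_matI) fastforce+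
  let ?F = "mat_diag n (\<lambda>i. complex_of_real (d i powr p))"
  let ?G = "mat_diag n (\<lambda>i. complex_of_real (e i powr p))"
  have F: "?F \<in> carrier_mat n n" and G: "?G \<in> carrier_mat n n" by auto
  have "B = V * ?V' * U * ?F * ?U'" using U V VV' F by (simp add: B)
  also have "\<dots> = V * (W * ?F) * ?U'"
    using U V U' V' F by (simp add: W_def assoc_mult_mat[of _ n n _ n _ n] mult_carrier_mat[of _ n n _ n])
  also have "\<dots> = V * (?G * W) * ?U'" by (simp only: pw)
  also have "\<dots> = V * ?G * ?V' * (U * ?U')"
    using U V U' V' G by (simp add: W_def assoc_mult_mat[of _ n n _ n _ n] mult_carrier_mat[of _ n n _ n])
  also have "\<dots> = B'" using V V' G by (simp add: UU' B' mn)
  finally show ?thesis .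
qed

lemma psd_powr_eqI: "spectral_powr_rel A p B \<Longrightarrow> psd_powr A p = B"
  unfolding psd_powr_def by (blast intro: spectral_powr_rel_unique)


subsection \<open>Partial derivatives\<close>

text \<open>
  \<open>tensor_slot q \<Phi>\<close> is \<open>id \<otimes> \<Phi> \<otimes> id\<close> for a linear map \<open>\<Phi>\<close> on the 2 by 2 matrices, where the
  last identity acts on the \<open>q\<close> by \<open>q\<close> matrices. An index \<open>r\<close> splits as \<open>(a * 2 + i) * q + b\<close>
  with \<open>i < 2\<close> the index in the middle factor. For fixed outer indices, \<open>slot_block\<close> is the
  2 by 2 matrix in the middle indices, to which \<open>\<Phi>\<close> is applied.
\<close>

definition slot_block :: "nat \<Rightarrow> complex mat \<Rightarrow> nat \<Rightarrow> nat \<Rightarrow> complex mat" where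
  "slot_block q T r c = mat 2 2 (\<lambda>(i, k).
     T $$ ((r div (2 * q) * 2 + i) * q + r mod q, (c div (2 * q) * 2 + k) * q + c mod q))"

definition tensor_slot :: "nat \<Rightarrow> (complex mat \<Rightarrow> complex mat) \<Rightarrow> complex mat \<Rightarrow> complex mat" where
  "tensor_slot q \<Phi> T = mat (dim_row T) (dim_col T) (\<lambda>(r, c).
     \<Phi> (slot_block q T r c) $$ (r div q mod 2, c div q mod 2))"

definition D2 :: "complex mat \<Rightarrow> complex mat" where
  "D2 A = A - ntr A \<cdot>\<^sub>m 1\<^sub>m 2"

definition partial_deriv :: "nat \<Rightarrow> nat \<Rightarrow> complex mat \<Rightarrow> complex mat" where
  "partial_deriv n j T = tensor_slot (2 ^ (n - j)) D2 T"

text \<open>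
  Being linear, \<open>partial_deriv n j\<close> is determined by its values on elementary tensors, computed in
  \<open>partial_deriv_kron\<close>.
\<close>

definition kron :: "complex mat \<Rightarrow> complex mat \<Rightarrow> complex mat" where
  "kron A B = mat (dim_row A * dim_row B) (dim_col A * dim_col B) (\<lambda>(r, c).
     A $$ (r div dim_row B, c div dim_col B) * B $$ (r mod dim_row B, c mod dim_col B))"

lemma ntr_smult: "ntr (s \<cdot>\<^sub>m A) = s * ntr A" if "A \<in> carrier_mat m m"
  using that by (simp add: ntr_def sum_distrib_left)

lemma ntr_add: "ntr (A + B) = ntr A + ntr B" if "A \<in> carrier_mat m m" "B \<in> carrier_mat m m"
  using that by (simp add: ntr_def sum.distrib add_divide_distrib)

lemma D2_smult: "D2 (s \<cdot>\<^sub>m A) = s \<cdot>\<^sub>m D2 A" if "A \<in> carrier_mat 2 2"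
  using that by (intro eq_matI) (auto simp: D2_def ntr_smult[OF that] algebra_simps)

lemma slot_index_bound:
  assumes "r < p * 2 * q" "i < 2" "0 < (q::nat)"
  shows "(r div (2 * q) * 2 + i) * q + r mod q < p * 2 * q"
proof -
  have "r div (2 * q) < p" using assms(1) by (simp add: less_mult_imp_div_less mult.assoc)
  hence "r div (2 * q) * 2 + i + 1 \<le> p * 2" using assms(2) by linarith
  hence "(r div (2 * q) * 2 + i + 1) * q \<le> p * 2 * q" by (rule mult_right_mono) simp
  moreover have "(r div (2 * q) * 2 + i + 1) * q = (r div (2 * q) * 2 + i) * q + q"
    by (simp add: distrib_right)
  moreover have "r mod q < q" using assms(3) by simp
  ultimately show ?thesis by linarith
qed

lemma partial_deriv_linear:
  assumes "A \<in> carrier_mat (2 ^ n) (2 ^ n)" "B \<in> carrier_mat (2 ^ n) (2 ^ n)" "j \<in> {1..n}"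
  shows "partial_deriv n j (s \<cdot>\<^sub>m A + B) = s \<cdot>\<^sub>m partial_deriv n j A + partial_deriv n j B"
proof -
  let ?q = "2 ^ (n - j) :: nat" and ?p = "2 ^ (j - 1) :: nat"
  have sz: "2 ^ n = ?p * (2 * ?q)"
  proof -
    have "n = (j - 1) + Suc (n - j)" using assms(3) by auto
    thus ?thesis by (metis power_add power_Suc)
  qed
  have bound: "(r div (2 * ?q) * 2 + i) * ?q + r mod ?q < 2 ^ n" if "r < 2 ^ n" "i < 2" for r i
    using slot_index_bound[of r ?p ?q i] that by (simp add: sz mult.assoc)
  have block: "slot_block ?q (s \<cdot>\<^sub>m A + B) r c = s \<cdot>\<^sub>m slot_block ?q A r c + slot_block ?q B r c"
    if "r < 2 ^ n" "c < 2 ^ n" for r c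
    using bound[OF that(1)] bound[OF that(2)] assms(1,2)
    by (intro eq_matI) (auto simp: slot_block_def)
  have carr: "slot_block ?q X r c \<in> carrier_mat 2 2" for X r c
    by (simp add: slot_block_def)
  have D2: "D2 (s \<cdot>\<^sub>m X + Y) $$ (i, k) = s * D2 X $$ (i, k) + D2 Y $$ (i, k)"
    if "X \<in> carrier_mat 2 2" "Y \<in> carrier_mat 2 2" "i < 2" "k < 2" for X Y i k
    using that ntr_add[of "s \<cdot>\<^sub>m X" 2 Y] ntr_smult[of X 2 s]
    by (simp add: D2_def algebra_simps)
  show ?thesis
    using assms(1,2)
    by (intro eq_matI) (auto simp: partial_deriv_def tensor_slot_def block D2[OF carr carr])
qed

lemma partial_deriv_kron:
  assumes "j \<in> {1..n}" and A: "A \<in> carrier_mat (2 ^ (j - 1)) (2 ^ (j - 1))"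
    and B: "B \<in> carrier_mat 2 2" and C: "C \<in> carrier_mat (2 ^ (n - j)) (2 ^ (n - j))"
  shows "partial_deriv n j (kron (kron A B) C) = kron (kron A (D2 B)) C"
proof -
  let ?q = "2 ^ (n - j) :: nat" and ?p = "2 ^ (j - 1) :: nat"
  have DB: "D2 B \<in> carrier_mat 2 2" using B by (auto simp: D2_def)
  have kk: "kron (kron A X) C $$ (r, c) =
      A $$ (r div ?q div 2, c div ?q div 2) * X $$ (r div ?q mod 2, c div ?q mod 2) *
      C $$ (r mod ?q, c mod ?q)"
    if "X \<in> carrier_mat 2 2" "r < ?p * 2 * ?q" "c < ?p * 2 * ?q" for X r c
    using that A C by (simp add: kron_def less_mult_imp_div_less)
  have bound: "(r div (2 * ?q) * 2 + i) * ?q + r mod ?q < ?p * 2 * ?q"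
    if "r < ?p * 2 * ?q" "i < 2" for r i
    by (rule slot_index_bound) (use that in auto)
  have dd: "((r div (2 * ?q) * 2 + i) * ?q + r mod ?q) div ?q = r div (2 * ?q) * 2 + i" for r i
    by simp
  have mm: "((r div (2 * ?q) * 2 + i) * ?q + r mod ?q) mod ?q = r mod ?q" for r i
    by simp
  have d2: "r div (2 * ?q) = r div ?q div 2" for r :: nat
    by (metis div_mult2_eq mult.commute)
  have block: "slot_block ?q (kron (kron A B) C) r c =
      (A $$ (r div ?q div 2, c div ?q div 2) * C $$ (r mod ?q, c mod ?q)) \<cdot>\<^sub>m B"
    if "r < ?p * 2 * ?q" "c < ?p * 2 * ?q" for r c
    using bound[OF that(1)] bound[OF that(2)] B
    by (intro eq_matI) (auto simp: slot_block_def kk[OF B] dd mm d2)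
  have dims: "kron (kron A X) C \<in> carrier_mat (?p * 2 * ?q) (?p * 2 * ?q)"
    if "X \<in> carrier_mat 2 2" for X
    using that A C by (simp add: kron_def)
  show ?thesis
    using dims[OF B] dims[OF DB] DB
    by (intro eq_matI)
      (auto simp: partial_deriv_def tensor_slot_def block D2_smult[OF B] kk[OF DB])
qed


subsection \<open>The index\<close>

text \<open>
  In HOL \<open>0 powr 0 = 0\<close>. The choice of value for \<open>0\<^sup>0\<close> only affects whether \<open>\<alpha> = 0\<close> belongs to
  the set, and not the infimum: since \<open>lp_norm 1 \<le> lp_norm 2\<close>, if \<open>0\<close> belongs to the set with this
  convention then so does every \<open>\<alpha> \<in> {0<..2}\<close>.
\<close>

definition ind :: "nat \<Rightarrow> complex mat \<Rightarrow> real" where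
  "ind n T = Inf {\<alpha>. 0 \<le> \<alpha> \<and> (\<forall>j\<in>{1..n}.
     lp_norm 1 (partial_deriv n j T) powr \<alpha> \<le> (lp_norm 2 (partial_deriv n j T))\<^sup>2)}"

end

theory Submission
  imports Defs "HOL-Analysis.L2_Norm"
begin

text \<open>
  The statement is a quantum form of the theorem of Kahn, Kalai and Linial, and it is true for
  the same reason: a function with small influences cannot have its variance concentrated on low
  Fourier levels, because hypercontractivity makes the low-level part of each derivative much
  smaller than the derivative itself.

  Expand \<open>T\<close> in Pauli words. A word is a pair \<open>w = (x, z)\<close> of \<open>n\<close>-bit numbers and stands for
  the operator that flips the bits of \<open>x\<close> and changes signs according to the bits of \<open>z\<close>; its
  support is the set of qubits on which \<open>x\<close> or \<open>z\<close> has a bit. The coefficients \<open>c(w)\<close> satisfy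
  Parseval's identity, and \<open>\<^bold>d\<^sub>j\<close> keeps exactly the words whose support contains the
  \<open>j\<close>-th qubit. So \<open>\<parallel>\<^bold>d\<^sub>j T\<parallel>\<^sub>2\<^sup>2\<close> is the weight of these words, and the sum of these
  influences is the sum of \<open>|supp w| |c(w)|\<^sup>2\<close>.

  The analytic core is the bound (\<open>noise_stability_bound\<close>)

    \<open>\<Sum>\<^sub>w 16\<^bsup>-|supp w|\<^esup> |c(w)|\<^sup>2 \<le> \<parallel>f\<parallel>\<^sub>1 \<parallel>f\<parallel>\<^sub>2\<close>   for every Hermitian \<open>f\<close>.

  Let \<open>h\<close> have the coefficients \<open>16\<^bsup>-|supp w|\<^esup> c(w)\<close>, so that the left-hand side \<open>S\<close> is
  \<open>tr(f\<^sup>* h)\<close>. In an eigenbasis of \<open>f\<close>, two applications of Cauchy--Schwarz bound it by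
  \<open>(\<parallel>f\<parallel>\<^sub>1 \<parallel>f\<parallel>\<^sub>2)\<^bsup>1/2\<^esup> \<parallel>h\<parallel>\<^sub>4\<close> (\<open>trace_duality\<close>), and \<open>\<parallel>h\<parallel>\<^sub>4 \<le> S\<^bsup>1/2\<^esup>\<close> by
  hypercontractivity. The latter reduces to a commutative statement: Pauli words multiply, up to
  phases, like the group of pairs of bit strings under bitwise addition, so the fourth moment
  \<open>tr((h\<^sup>* h)\<^sup>2)\<close> is at most the same convolution expression in the moduli of the coefficients
  (\<open>pauli_coeff_adjoint_mult\<close>). For nonnegative functions on an elementary abelian 2-group the
  required inequality holds on two points and is stable under products
  (\<open>hypercontractive_tensor\<close>).

  For a projection of index \<open>\<iota> < 2\<close>, an exponent \<open>\<beta> < 2\<close> depending on \<open>\<iota>\<close> only makes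
  \<open>\<parallel>\<^bold>d\<^sub>j T\<parallel>\<^sub>1 \<le> I\<^sub>j\<^bsup>1/\<beta>\<^esup>\<close> with \<open>I\<^sub>j = \<parallel>\<^bold>d\<^sub>j T\<parallel>\<^sub>2\<^sup>2\<close>. Apply the core bound to all
  \<open>f = \<^bold>d\<^sub>j T\<close> and add: the sum of \<open>|supp w| 16\<^bsup>-|supp w|\<^esup> |c(w)|\<^sup>2\<close> is at most
  \<open>n M\<^bsup>1+\<delta>\<^esup>\<close>, where \<open>M\<close> is the largest influence and \<open>\<delta> = 1/\<beta> - 1/2 > 0\<close>. On the other
  hand the nonempty words carry total weight \<open>1/4\<close> and have average support size at most
  \<open>4 n M\<close>, so this sum is at least \<open>16\<^bsup>-8 n M\<^esup> / 8\<close>. Comparing the two gives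
  \<open>n M \<ge> C log n\<close>.
\<close>


section \<open>Unitary diagonalization of Hermitian matrices\<close>

lemma index_mat_adjoint [simp]:
  fixes A :: "complex mat"
  assumes "i < dim_col A" "j < dim_row A"
  shows "mat_adjoint A $$ (i, j) = cnj (A $$ (j, i))"
  using assms by (simp add: mat_adjoint_def mat_of_rows_index cols_def)

lemma dim_mat_adjoint [simp]:
  "dim_row (mat_adjoint A) = dim_col A" "dim_col (mat_adjoint A) = dim_row A"
  by (auto simp: mat_adjoint_def)

lemma index_mult_mat_sum:
  assumes "A \<in> carrier_mat n m" "B \<in> carrier_mat m k" "i < n" "j < k"
  shows "(A * B) $$ (i, j) = (\<Sum>l<m. A $$ (i, l) * B $$ (l, j))"
  using assms by (simp add: scalar_prod_def atLeast0LessThan)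

lemma mat_adjoint_mult:
  fixes A B :: "complex mat"
  assumes "A \<in> carrier_mat n m" "B \<in> carrier_mat m k"
  shows "mat_adjoint (A * B) = mat_adjoint B * mat_adjoint A"
proof (rule eq_matI)
  fix i j assume "i < dim_row (mat_adjoint B * mat_adjoint A)" "j < dim_col (mat_adjoint B * mat_adjoint A)"
  hence ij: "i < k" "j < n" using assms by auto
  have "mat_adjoint (A * B) $$ (i, j) = cnj ((A * B) $$ (j, i))"
    using ij assms by (subst index_mat_adjoint) auto
  also have "\<dots> = (\<Sum>l<m. cnj (A $$ (j, l)) * cnj (B $$ (l, i)))"
    using ij assms by (simp add: index_mult_mat_sum[OF assms] del: index_mult_mat)
  also have "\<dots> = (\<Sum>l<m. mat_adjoint B $$ (i, l) * mat_adjoint A $$ (l, j))"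
    using ij assms by (intro sum.cong) auto
  also have "\<dots> = (mat_adjoint B * mat_adjoint A) $$ (i, j)"
    using ij assms by (subst index_mult_mat_sum[of _ k m _ n]) (auto intro: mat_adjoint_carrier)
  finally show "mat_adjoint (A * B) $$ (i, j) = (mat_adjoint B * mat_adjoint A) $$ (i, j)" .
qed (use assms in auto)

lemma mat_adjoint_adjoint [simp]: "mat_adjoint (mat_adjoint A) = (A :: complex mat)"
  by (rule eq_matI) auto

text \<open>
  An eigenvector exists by the fundamental theorem of algebra; Gram--Schmidt, started at it,
  extends it to an orthogonal basis, which only has to be normalized. This is the step that splits
  off one dimension in the diagonalization below.
\<close>

lemma orthonormal_completion_of_eigenvector:
  fixes A :: "complex mat"
  assumes A: "A \<in> carrier_mat n n" and n: "n \<noteq> 0"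
  obtains W e where "W \<in> carrier_mat n n" "mat_adjoint W * W = 1\<^sub>m n"
    "\<And>i. i < n \<Longrightarrow> (A * W) $$ (i, 0) = e * W $$ (i, 0)"
proof -
  have "\<not> constant (poly (char_poly A))"
    using degree_monic_char_poly[OF A] n by (simp add: constant_degree)
  then obtain e where "poly (char_poly A) e = 0"
    using fundamental_theorem_of_algebra by blast
  hence "eigenvalue A e" by (simp add: eigenvalue_root_char_poly[OF A])
  then obtain v where v: "v \<in> carrier_vec n" "v \<noteq> 0\<^sub>v n" "A *\<^sub>v v = e \<cdot>\<^sub>v v"
    using A unfolding eigenvalue_def eigenvector_def by auto
  define ws where "ws = gram_schmidt n (basis_completion v)"
  interpret cof_vec_space n "TYPE(complex)" .
  note bc = basis_completion[OF v(1,2)]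
  obtain vs where bv: "basis_completion v = v # vs"
    by (simp add: basis_completion_def Let_def)
  note gs = gram_schmidt_result[OF bc(2) bc(4) bc(5) refl, folded ws_def]
  have ws: "set ws \<subseteq> carrier_vec n" "corthogonal ws" "length ws = n"
    using gs bc(6) by auto
  have "hd ws = v" using gram_schmidt_hd[OF v(1), of vs] by (simp add: ws_def bv)
  hence ws0: "ws ! 0 = v" using ws(3) n hd_conv_nth[of ws] by auto
  have wsc: "ws ! j \<in> carrier_vec n" if "j < n" for j using ws that by auto
  \<comment> \<open>squared lengths of the basis vectors, which Gram--Schmidt leaves unnormalized\<close>
  define s where "s j = (\<Sum>k<n. (cmod (ws ! j $ k))\<^sup>2)" for j
  have ip: "ws ! i \<bullet>c ws ! j = (\<Sum>k<n. ws ! i $ k * cnj (ws ! j $ k))" if "i < n" "j < n" for i j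
    using wsc[OF that(1)] wsc[OF that(2)] by (simp add: scalar_prod_def atLeast0LessThan)
  have orth: "(\<Sum>k<n. ws ! i $ k * cnj (ws ! j $ k)) = (if i = j then of_real (s j) else 0)"
    if "i < n" "j < n" for i j
  proof (cases "i = j")
    case True
    thus ?thesis unfolding s_def of_real_sum complex_norm_square by simp
  next
    case False
    thus ?thesis using ip[OF that] corthogonalD[OF ws(2), of i j] that ws(3) by simp
  qed
  have s_pos: "s j > 0" if "j < n" for j
  proof -
    have "ws ! j \<bullet>c ws ! j \<noteq> 0" using corthogonalD[OF ws(2), of j j] that ws(3) by simp
    hence "s j \<noteq> 0" using ip[OF that that] orth[OF that that] by auto
    moreover have "s j \<ge> 0" unfolding s_def by (intro sum_nonneg) auto
    ultimately show ?thesis by simp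
  qed
  define W where "W = mat n n (\<lambda>(k, j). ws ! j $ k / of_real (sqrt (s j)))"
  have W: "W \<in> carrier_mat n n" by (simp add: W_def)
  have "mat_adjoint W * W = 1\<^sub>m n"
  proof (rule eq_matI)
    fix i j assume "i < dim_row (1\<^sub>m n)" "j < dim_col (1\<^sub>m n)"
    hence ij: "i < n" "j < n" by auto
    have "(mat_adjoint W * W) $$ (i, j) = (\<Sum>k<n. ws ! j $ k * cnj (ws ! i $ k)) / of_real (sqrt (s i) * sqrt (s j))"
      using ij W by (subst index_mult_mat_sum[OF mat_adjoint_carrier[OF W] W])
        (auto simp: W_def sum_divide_distrib mult_ac)
    also have "\<dots> = 1\<^sub>m n $$ (i, j)"
      using ij s_pos[OF ij(1)] by (auto simp: orth simp flip: of_real_mult)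
    finally show "(mat_adjoint W * W) $$ (i, j) = 1\<^sub>m n $$ (i, j)" .
  qed (use W in auto)
  moreover have "(A * W) $$ (i, 0) = e * W $$ (i, 0)" if i: "i < n" for i
  proof -
    have "(A * W) $$ (i, 0) = (\<Sum>k<n. A $$ (i, k) * v $ k) / of_real (sqrt (s 0))"
      using i n by (subst index_mult_mat_sum[OF A W]) (auto simp: W_def ws0 sum_divide_distrib)
    also have "(\<Sum>k<n. A $$ (i, k) * v $ k) = (A *\<^sub>v v) $ i"
      using i A v(1) by (simp add: scalar_prod_def atLeast0LessThan)
    also have "\<dots> = e * v $ i" using v i by simp
    finally show ?thesis using i n by (simp add: W_def ws0)
  qed
  ultimately show ?thesis using that[OF W] by blast
qed

text \<open>
  Induction on the size: in an orthonormal basis that starts with an eigenvector, the first column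
  of the matrix vanishes below the diagonal and, the matrix being Hermitian, so does the first row
  to the right of it.
\<close>

theorem hermitian_diagonalization:
  fixes A :: "complex mat"
  assumes "A \<in> carrier_mat n n" "mat_adjoint A = A"
  shows "\<exists>U d. U \<in> carrier_mat n n \<and> mat_adjoint U * U = 1\<^sub>m n \<and>
    A = U * mat_diag n (\<lambda>i. complex_of_real (d i)) * mat_adjoint U"
  using assms
proof (induction n arbitrary: A)
  case 0
  have "A = 1\<^sub>m 0 * mat_diag 0 (\<lambda>i. complex_of_real (0::real)) * mat_adjoint (1\<^sub>m 0)"
    using 0 by (intro eq_matI) auto
  moreover have "mat_adjoint (1\<^sub>m 0) * 1\<^sub>m 0 = (1\<^sub>m 0 :: complex mat)"
    by (intro eq_matI) auto
  ultimately show ?case by (intro exI[of _ "1\<^sub>m 0"] exI[of _ "\<lambda>_. 0"]) auto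
next
  case (Suc n)
  note A = Suc.prems(1)
  obtain W e where W: "W \<in> carrier_mat (Suc n) (Suc n)" "mat_adjoint W * W = 1\<^sub>m (Suc n)"
    and ev: "\<And>i. i < Suc n \<Longrightarrow> (A * W) $$ (i, 0) = e * W $$ (i, 0)"
    using orthonormal_completion_of_eigenvector[OF A] by auto
  note W' = mat_adjoint_carrier[OF W(1)]
  have WW': "W * mat_adjoint W = 1\<^sub>m (Suc n)"
    using mat_mult_left_right_inverse[OF W' W(1) W(2)] .
  define B where "B = mat_adjoint W * (A * W)"
  have AW: "A * W \<in> carrier_mat (Suc n) (Suc n)" using A W by simp
  have B: "B \<in> carrier_mat (Suc n) (Suc n)" using W' AW unfolding B_def by simp
  have B_herm: "mat_adjoint B = B"
    unfolding B_def using A W' W Suc.prems(2)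
    by (simp add: mat_adjoint_mult[OF W' AW] mat_adjoint_mult[OF A W(1)] assoc_mult_mat[of _ "Suc n" "Suc n" _ "Suc n" _ "Suc n"])
  have B_col: "B $$ (i, 0) = (if i = 0 then e else 0)" if "i < Suc n" for i
  proof -
    have "B $$ (i, 0) = (\<Sum>k<Suc n. mat_adjoint W $$ (i, k) * (A * W) $$ (k, 0))"
      unfolding B_def using that by (intro index_mult_mat_sum[OF W' AW]) auto
    also have "\<dots> = e * (\<Sum>k<Suc n. mat_adjoint W $$ (i, k) * W $$ (k, 0))"
      unfolding sum_distrib_left by (intro sum.cong) (simp_all add: ev del: index_mult_mat)
    also have "(\<Sum>k<Suc n. mat_adjoint W $$ (i, k) * W $$ (k, 0)) = (mat_adjoint W * W) $$ (i, 0)"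
      using that by (intro index_mult_mat_sum[OF W' W(1), symmetric]) auto
    finally show ?thesis using that by (simp add: W(2))
  qed
  have B_cnj: "B $$ (i, j) = cnj (B $$ (j, i))" if "i < Suc n" "j < Suc n" for i j
    using index_mat_adjoint[of i B j] B that by (simp add: B_herm)
  have B_row: "B $$ (0, j) = 0" if "0 < j" "j < Suc n" for j
    using B_cnj[of 0 j] B_col[of j] that by simp
  have e_real: "e = complex_of_real (Re e)"
    using B_cnj[of 0 0] B_col[of 0] by (simp add: complex_eq_iff)
  define A3 where "A3 = mat n n (\<lambda>(i, j). B $$ (Suc i, Suc j))"
  have A3: "A3 \<in> carrier_mat n n" by (simp add: A3_def)
  have "mat_adjoint A3 = A3"
    by (intro eq_matI) (auto simp: A3_def intro: B_cnj[symmetric])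
  then obtain U d where U: "U \<in> carrier_mat n n" "mat_adjoint U * U = 1\<^sub>m n"
    and A3_eq: "A3 = U * mat_diag n (\<lambda>i. complex_of_real (d i)) * mat_adjoint U"
    using Suc.IH[OF A3] by blast
  note U' = mat_adjoint_carrier[OF U(1)]
  \<comment> \<open>block-diagonal extension of a smaller matrix by one entry in the upper left corner\<close>
  define bl where "bl c X = four_block_mat (mat 1 1 (\<lambda>_. c)) (0\<^sub>m 1 n) (0\<^sub>m n 1) X"
    for c and X :: "complex mat"
  have bl_mult: "bl a X * bl b Y = bl (a * b) (X * Y)"
    if "X \<in> carrier_mat n n" "Y \<in> carrier_mat n n" for a b X Y
  proof -
    have "mat 1 1 (\<lambda>_. a) * mat 1 1 (\<lambda>_. b) = mat 1 1 (\<lambda>_. a * b)"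
      by (rule eq_matI) (auto simp: scalar_prod_def)
    thus ?thesis
      unfolding bl_def using that
      by (subst mult_four_block_mat[of _ 1 1 _ n _ n _ _ 1 _ n]) auto
  qed
  define d' where "d' i = (case i of 0 \<Rightarrow> Re e | Suc k \<Rightarrow> d k)" for i
  have blc: "bl c X \<in> carrier_mat (Suc n) (Suc n)" if "X \<in> carrier_mat n n" for c X
    using that unfolding bl_def by auto
  have adj_bl: "mat_adjoint (bl 1 U) = bl 1 (mat_adjoint U)"
    using U by (intro eq_matI) (auto simp: bl_def)
  have diag: "mat_diag (Suc n) (\<lambda>i. complex_of_real (d' i)) =
    bl e (mat_diag n (\<lambda>i. complex_of_real (d i)))"
    using e_real by (intro eq_matI) (auto simp: bl_def d'_def mat_diag_def split: nat.split)
  have "B = bl e A3"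
    using B B_col B_row by (intro eq_matI) (auto simp: bl_def A3_def)
  also have "\<dots> = bl 1 U * bl e (mat_diag n (\<lambda>i. complex_of_real (d i))) * bl 1 (mat_adjoint U)"
    using U(1) U' by (simp add: A3_eq bl_mult mult_carrier_mat[of _ n n _ n])
  finally have B_eq: "B = bl 1 U * mat_diag (Suc n) (\<lambda>i. complex_of_real (d' i)) * bl 1 (mat_adjoint U)"
    by (simp add: diag)
  have "bl 1 (1\<^sub>m n) = 1\<^sub>m (Suc n)"
    by (intro eq_matI) (auto simp: bl_def)
  hence bb: "bl 1 (mat_adjoint U) * bl 1 U = 1\<^sub>m (Suc n)"
    using U U' by (simp add: bl_mult)
  let ?D = "mat_diag (Suc n) (\<lambda>i. complex_of_real (d' i))"
  have D: "?D \<in> carrier_mat (Suc n) (Suc n)" by simp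
  note assoc = assoc_mult_mat[of _ "Suc n" "Suc n" _ "Suc n" _ "Suc n"]
  define V where "V = W * bl 1 U"
  have V: "V \<in> carrier_mat (Suc n) (Suc n)" using W blc[OF U(1)] by (simp add: V_def)
  have V': "mat_adjoint V = bl 1 (mat_adjoint U) * mat_adjoint W"
    unfolding V_def using mat_adjoint_mult[OF W(1) blc[OF U(1)]] by (simp add: adj_bl)
  have "mat_adjoint V * V = bl 1 (mat_adjoint U) * (mat_adjoint W * W) * bl 1 U"
    unfolding V' unfolding V_def using W(1) W' blc[OF U(1)] blc[OF U'] by (simp add: assoc mult_carrier_mat[of _ "Suc n" "Suc n" _ "Suc n"])
  hence 1: "mat_adjoint V * V = 1\<^sub>m (Suc n)"
    by (simp add: W(2) bb right_mult_one_mat[OF blc[OF U']])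
  have "A = W * mat_adjoint W * A * (W * mat_adjoint W)"
    using A by (simp add: WW')
  also have "\<dots> = W * B * mat_adjoint W"
    unfolding B_def using A W(1) W' by (simp add: assoc mult_carrier_mat[of _ "Suc n" "Suc n" _ "Suc n"])
  also have "\<dots> = V * ?D * mat_adjoint V"
    unfolding V' unfolding V_def B_eq using W(1) W' D blc[OF U(1)] blc[OF U']
    by (simp add: assoc mult_carrier_mat[of _ "Suc n" "Suc n" _ "Suc n"])
  finally show ?case using V 1 by blast
qed


section \<open>Normalized trace and Schatten norms of Hermitian matrices\<close>

lemma cauchy_schwarz_sum_square:
  fixes x y :: "'i \<Rightarrow> real"
  shows "(\<Sum>i\<in>I. x i * y i)\<^sup>2 \<le> (\<Sum>i\<in>I. (x i)\<^sup>2) * (\<Sum>i\<in>I. (y i)\<^sup>2)"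
proof -
  have "\<bar>\<Sum>i\<in>I. x i * y i\<bar> \<le> (\<Sum>i\<in>I. \<bar>x i\<bar> * \<bar>y i\<bar>)"
    by (rule order_trans[OF sum_abs]) (simp add: abs_mult)
  also have "\<dots> \<le> L2_set x I * L2_set y I" by (rule L2_set_mult_ineq)
  finally have "\<bar>\<Sum>i\<in>I. x i * y i\<bar>\<^sup>2 \<le> (L2_set x I * L2_set y I)\<^sup>2"
    by (intro power_mono) auto
  thus ?thesis by (simp add: L2_set_def power_mult_distrib sum_nonneg)
qed

lemma cauchy_schwarz_sum:
  fixes x y :: "'i \<Rightarrow> real"
  shows "(\<Sum>i\<in>I. x i * y i) \<le> sqrt (\<Sum>i\<in>I. (x i)\<^sup>2) * sqrt (\<Sum>i\<in>I. (y i)\<^sup>2)"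
  using real_le_rsqrt[OF cauchy_schwarz_sum_square[of x y I]] by (simp add: real_sqrt_mult)

lemma ntr_adjoint_mult:
  assumes "A \<in> carrier_mat N N" "B \<in> carrier_mat N N"
  shows "ntr (mat_adjoint A * B) = (\<Sum>r<N. \<Sum>c<N. cnj (A $$ (r, c)) * B $$ (r, c)) / of_nat N"
proof -
  have "ntr (mat_adjoint A * B) = (\<Sum>c<N. \<Sum>r<N. mat_adjoint A $$ (c, r) * B $$ (r, c)) / of_nat N"
    using assms unfolding ntr_def
    by (intro arg_cong2[of _ _ _ _ "(/)"] sum.cong index_mult_mat_sum[OF mat_adjoint_carrier[OF assms(1)] assms(2)]) auto
  also have "\<dots> = (\<Sum>c<N. \<Sum>r<N. cnj (A $$ (r, c)) * B $$ (r, c)) / of_nat N"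
    using assms by (intro arg_cong2[of _ _ _ _ "(/)"] sum.cong refl) auto
  finally show ?thesis by (subst sum.swap)
qed

lemma ntr_mult_commute:
  assumes "A \<in> carrier_mat N N" "B \<in> carrier_mat N N"
  shows "ntr (A * B) = ntr (B * A)"
proof -
  have "ntr (A * B) = (\<Sum>r<N. \<Sum>c<N. A $$ (r, c) * B $$ (c, r)) / of_nat N"
    using assms unfolding ntr_def
    by (intro arg_cong2[of _ _ _ _ "(/)"] sum.cong index_mult_mat_sum[OF assms]) auto
  also have "\<dots> = (\<Sum>r<N. \<Sum>c<N. B $$ (r, c) * A $$ (c, r)) / of_nat N"
    by (subst sum.swap) (simp add: mult.commute)
  also have "\<dots> = ntr (B * A)"
    using assms unfolding ntr_def
    by (intro arg_cong2[of _ _ _ _ "(/)"] sum.cong index_mult_mat_sum[OF assms(2,1), symmetric]) auto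
  finally show ?thesis .
qed

lemma ntr_mat_diag_mult:
  assumes "B \<in> carrier_mat N N"
  shows "ntr (mat_diag N d * B) = (\<Sum>i<N. d i * B $$ (i, i)) / of_nat N"
  using assms by (simp add: ntr_def mat_diag_mult_left[OF assms])

lemma ntr_mat_diag: "ntr (mat_diag N d) = (\<Sum>i<N. d i) / of_nat N"
  by (simp add: ntr_def mat_diag_def)

lemma ntr_unitary_conj:
  assumes "U \<in> carrier_mat N N" "mat_adjoint U * U = 1\<^sub>m N" "A \<in> carrier_mat N N"
  shows "ntr (U * A * mat_adjoint U) = ntr A"
proof -
  note U' = mat_adjoint_carrier[OF assms(1)]
  have "ntr (U * A * mat_adjoint U) = ntr (mat_adjoint U * (U * A))"
    by (rule ntr_mult_commute[OF mult_carrier_mat[OF assms(1,3)] U'])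
  also have "mat_adjoint U * (U * A) = mat_adjoint U * U * A"
    using assms U' by (intro assoc_mult_mat[symmetric]) auto
  finally show ?thesis using assms by simp
qed

lemma mat_diag_adjoint: "mat_adjoint (mat_diag N (\<lambda>i. complex_of_real (d i))) = mat_diag N (\<lambda>i. complex_of_real (d i))"
  by (intro eq_matI) (auto simp: mat_diag_def)

lemma unitary_conj_mult:
  fixes U A :: "complex mat"
  assumes U: "U \<in> carrier_mat N N" "mat_adjoint U * U = 1\<^sub>m N"
    and A: "A \<in> carrier_mat N N" and B: "B \<in> carrier_mat N N"
  shows "(U * A * mat_adjoint U) * (U * B * mat_adjoint U) = U * (A * B) * mat_adjoint U"
proof -
  note U' = mat_adjoint_carrier[OF U(1)]
  note assoc = assoc_mult_mat[of _ N N _ N _ N] mult_carrier_mat[of _ N N _ N]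
  have "(U * A * mat_adjoint U) * (U * B * mat_adjoint U) = U * A * (mat_adjoint U * U) * B * mat_adjoint U"
    using U(1) U' A B by (simp add: assoc)
  also have "\<dots> = U * A * B * mat_adjoint U"
    using U A by (simp add: right_mult_one_mat[of _ N N] mult_carrier_mat[of _ N N _ N])
  finally show ?thesis using U(1) A B by (simp add: assoc_mult_mat[of _ N N _ N _ N])
qed

lemma unitary_conj_adjoint:
  fixes U A :: "complex mat"
  assumes U: "U \<in> carrier_mat N N" and A: "A \<in> carrier_mat N N"
  shows "mat_adjoint (U * A * mat_adjoint U) = U * mat_adjoint A * mat_adjoint U"
proof -
  note U' = mat_adjoint_carrier[OF U] and A' = mat_adjoint_carrier[OF A]
  have "mat_adjoint (U * A * mat_adjoint U) = U * (mat_adjoint A * mat_adjoint U)"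
    using mat_adjoint_mult[OF mult_carrier_mat[OF U A] U'] mat_adjoint_mult[OF U A] by simp
  thus ?thesis using assoc_mult_mat[OF U A' U'] by simp
qed

text \<open>
  \<open>mat_abs\<close> and \<open>lp_norm\<close> are defined by definite descriptions. An
  explicit diagonalization provides the object described, here and in the next lemma.
\<close>

lemma mat_abs_diagonalized:
  assumes U: "U \<in> carrier_mat N N" "mat_adjoint U * U = 1\<^sub>m N"
    and f: "f = U * mat_diag N (\<lambda>i. complex_of_real (d i)) * mat_adjoint U"
  shows "mat_abs f = U * mat_diag N (\<lambda>i. complex_of_real \<bar>d i\<bar>) * mat_adjoint U"
proof -
  have ff: "mat_adjoint f * f = U * mat_diag N (\<lambda>i. complex_of_real ((d i)\<^sup>2)) * mat_adjoint U"
    unfolding f unitary_conj_adjoint[OF U(1) mat_diag_dim] mat_diag_adjoint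
      unitary_conj_mult[OF U mat_diag_dim mat_diag_dim]
    by (simp add: power2_eq_square)
  have "(d i)\<^sup>2 powr (1 / 2) = \<bar>d i\<bar>" for i by (simp add: powr_half_sqrt)
  hence "spectral_powr_rel (mat_adjoint f * f) (1 / 2) (U * mat_diag N (\<lambda>i. complex_of_real \<bar>d i\<bar>) * mat_adjoint U)"
    unfolding spectral_powr_rel_def
    by (intro exI[of _ N] exI[of _ U] exI[of _ "\<lambda>i. (d i)\<^sup>2"]) (use U ff in simp)
  thus ?thesis unfolding mat_abs_def by (rule psd_powr_eqI)
qed

lemma lp_norm_diagonalized:
  assumes U: "U \<in> carrier_mat N N" "mat_adjoint U * U = 1\<^sub>m N"
    and f: "f = U * mat_diag N (\<lambda>i. complex_of_real (d i)) * mat_adjoint U"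
  shows "lp_norm p f = ((\<Sum>i<N. \<bar>d i\<bar> powr p) / N) powr (1 / p)"
proof -
  have "spectral_powr_rel (mat_abs f) p (U * mat_diag N (\<lambda>i. complex_of_real (\<bar>d i\<bar> powr p)) * mat_adjoint U)"
    unfolding spectral_powr_rel_def
    by (intro exI[of _ N] exI[of _ U] exI[of _ "\<lambda>i. \<bar>d i\<bar>"]) (use U mat_abs_diagonalized[OF assms] in simp)
  hence "psd_powr (mat_abs f) p = U * mat_diag N (\<lambda>i. complex_of_real (\<bar>d i\<bar> powr p)) * mat_adjoint U"
    by (rule psd_powr_eqI)
  hence "ntr (psd_powr (mat_abs f) p) = of_real ((\<Sum>i<N. \<bar>d i\<bar> powr p) / N)"
    using U by (simp add: ntr_unitary_conj ntr_mat_diag)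
  thus ?thesis by (simp add: lp_norm_def)
qed

lemma mat_abs_square:
  assumes f: "f \<in> carrier_mat N N" "mat_adjoint f = f"
  shows "mat_abs f * mat_abs f = f * f"
proof -
  obtain U d where U: "U \<in> carrier_mat N N" "mat_adjoint U * U = 1\<^sub>m N"
    and fe: "f = U * mat_diag N (\<lambda>i. complex_of_real (d i)) * mat_adjoint U"
    using hermitian_diagonalization[OF f] by blast
  have "complex_of_real \<bar>d i\<bar> * complex_of_real \<bar>d i\<bar> = complex_of_real (d i) * complex_of_real (d i)" for i
    by (simp flip: of_real_mult)
  thus ?thesis
    unfolding mat_abs_diagonalized[OF U fe]
    by (subst (1 2) fe) (simp add: unitary_conj_mult[OF U])
qed

lemma lp_norm_one_diagonalized:
  assumes "U \<in> carrier_mat N N" "mat_adjoint U * U = 1\<^sub>m N"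
    and "f = U * mat_diag N (\<lambda>i. complex_of_real (d i)) * mat_adjoint U"
  shows "lp_norm 1 f = (\<Sum>i<N. \<bar>d i\<bar>) / N"
  unfolding lp_norm_diagonalized[OF assms] by (simp add: sum_nonneg)

lemma lp_norm_two_diagonalized:
  assumes "U \<in> carrier_mat N N" "mat_adjoint U * U = 1\<^sub>m N"
    and "f = U * mat_diag N (\<lambda>i. complex_of_real (d i)) * mat_adjoint U"
  shows "(lp_norm 2 f)\<^sup>2 = (\<Sum>i<N. (d i)\<^sup>2) / N"
proof -
  have "\<bar>x\<bar> powr 2 = x\<^sup>2" for x :: real
    by (simp add: powr_numeral)
  thus ?thesis
    unfolding lp_norm_diagonalized[OF assms] by (simp add: powr_half_sqrt sum_nonneg)
qed

lemma lp_norm_nonneg: "lp_norm p f \<ge> 0"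
  by (simp add: lp_norm_def)

lemma lp_norm_two_hermitian:
  assumes f: "f \<in> carrier_mat N N" "mat_adjoint f = f"
  shows "(lp_norm 2 f)\<^sup>2 = Re (ntr (mat_adjoint f * f))"
proof -
  obtain U d where U: "U \<in> carrier_mat N N" "mat_adjoint U * U = 1\<^sub>m N"
    and fe: "f = U * mat_diag N (\<lambda>i. complex_of_real (d i)) * mat_adjoint U"
    using hermitian_diagonalization[OF f] by blast
  have "f * f = U * mat_diag N (\<lambda>i. complex_of_real ((d i)\<^sup>2)) * mat_adjoint U"
    by (subst (1 2) fe) (simp add: unitary_conj_mult[OF U] power2_eq_square)
  hence "ntr (f * f) = of_real ((\<Sum>i<N. (d i)\<^sup>2) / N)"
    using U by (simp add: ntr_unitary_conj ntr_mat_diag)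
  thus ?thesis
    using lp_norm_two_diagonalized[OF U fe] f(2) by simp
qed

lemma lp_norm_one_le_two:
  assumes f: "f \<in> carrier_mat N N" "mat_adjoint f = f"
  shows "(lp_norm 1 f)\<^sup>2 \<le> (lp_norm 2 f)\<^sup>2"
proof -
  obtain U d where U: "U \<in> carrier_mat N N" "mat_adjoint U * U = 1\<^sub>m N"
    and fe: "f = U * mat_diag N (\<lambda>i. complex_of_real (d i)) * mat_adjoint U"
    using hermitian_diagonalization[OF f] by blast
  have "(\<Sum>i<N. 1 * \<bar>d i\<bar>)\<^sup>2 \<le> (\<Sum>i<N. 1\<^sup>2) * (\<Sum>i<N. \<bar>d i\<bar>\<^sup>2)"
    by (rule cauchy_schwarz_sum_square)
  hence "(\<Sum>i<N. \<bar>d i\<bar>)\<^sup>2 \<le> N * (\<Sum>i<N. (d i)\<^sup>2)" by simp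
  thus ?thesis
    unfolding lp_norm_one_diagonalized[OF U fe] lp_norm_two_diagonalized[OF U fe]
    by (cases "N = 0") (auto simp: power_divide divide_simps power2_eq_square mult_ac)
qed

text \<open>
  By \<open>|k\<^sub>i\<^sub>i|\<^sup>2 \<le> (k\<^sup>* k)\<^sub>i\<^sub>i\<close>, the fourth
  powers of the diagonal entries are at most the squares of the diagonal entries of
  \<open>k\<^sup>* k\<close>, and so at most the squared Hilbert--Schmidt norm of \<open>k\<^sup>*
  k\<close>, which is the fourth moment of \<open>k\<close>.
\<close>

lemma diagonal_fourth_moment:
  assumes k: "k \<in> carrier_mat N N"
  shows "(\<Sum>i<N. ((cmod (k $$ (i, i)))\<^sup>2)\<^sup>2) / N \<le> Re (ntr (mat_adjoint (mat_adjoint k * k) * (mat_adjoint k * k)))"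
proof -
  let ?m = "mat_adjoint k * k"
  have m: "?m \<in> carrier_mat N N" using k mat_adjoint_carrier[OF k] by simp
  have "((cmod (k $$ (i, i)))\<^sup>2)\<^sup>2 \<le> (\<Sum>j<N. (cmod (?m $$ (i, j)))\<^sup>2)" if i: "i < N" for i
  proof -
    have "?m $$ (i, i) = (\<Sum>l<N. of_real ((cmod (k $$ (l, i)))\<^sup>2))"
      unfolding complex_norm_square using i k
      by (subst index_mult_mat_sum[OF mat_adjoint_carrier[OF k] k]) (auto simp: mult.commute)
    hence mi: "?m $$ (i, i) = of_real (\<Sum>l<N. (cmod (k $$ (l, i)))\<^sup>2)" by simp
    have "(cmod (k $$ (i, i)))\<^sup>2 \<le> (\<Sum>l<N. (cmod (k $$ (l, i)))\<^sup>2)"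
      using i by (intro member_le_sum[of i]) auto
    also have "\<dots> = cmod (?m $$ (i, i))" unfolding mi by (simp only: norm_of_real) (simp add: sum_nonneg)
    finally have "((cmod (k $$ (i, i)))\<^sup>2)\<^sup>2 \<le> (cmod (?m $$ (i, i)))\<^sup>2" by (intro power_mono) auto
    also have "\<dots> \<le> (\<Sum>j<N. (cmod (?m $$ (i, j)))\<^sup>2)"
      using i by (intro member_le_sum[of i "{..<N}" "\<lambda>j. (cmod (?m $$ (i, j)))\<^sup>2"]) auto
    finally show ?thesis .
  qed
  hence "(\<Sum>i<N. ((cmod (k $$ (i, i)))\<^sup>2)\<^sup>2) \<le> (\<Sum>i<N. \<Sum>j<N. (cmod (?m $$ (i, j)))\<^sup>2)"
    by (intro sum_mono) auto
  moreover have "cnj z * z = of_real ((cmod z)\<^sup>2)" for z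
    by (subst complex_norm_square) (simp add: mult.commute)
  hence "Re (ntr (mat_adjoint ?m * ?m)) = (\<Sum>i<N. \<Sum>j<N. (cmod (?m $$ (i, j)))\<^sup>2) / N"
    unfolding ntr_adjoint_mult[OF m m] by (simp del: of_real_power add: Re_divide_of_nat)
  ultimately show ?thesis by (simp add: divide_right_mono)
qed

text \<open>
  This is Hoelder's inequality \<open>|tr(f\<^sup>* h)| \<le>
  \<parallel>f\<parallel>\<^bsub>4/3\<^esub> \<parallel>h\<parallel>\<^sub>4\<close> combined with
  the interpolation \<open>\<parallel>f\<parallel>\<^bsub>4/3\<^esub>\<^sup>2 \<le>
  \<parallel>f\<parallel>\<^sub>1 \<parallel>f\<parallel>\<^sub>2\<close>. In an eigenbasis of
  \<open>f\<close> only the diagonal entries of \<open>h\<close> matter, so both amount to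
  Cauchy--Schwarz for finite sums, applied to \<open>\<Sum> |d\<^sub>i|
  |h\<^sub>i\<^sub>i|\<close> and then to \<open>\<Sum> |d\<^sub>i|
  |h\<^sub>i\<^sub>i|\<^sup>2\<close>.
\<close>

lemma trace_duality:
  assumes f: "f \<in> carrier_mat N N" "mat_adjoint f = f" and h: "h \<in> carrier_mat N N"
  shows "((cmod (ntr (mat_adjoint f * h)))\<^sup>2)\<^sup>2 \<le> (lp_norm 1 f)\<^sup>2 * (lp_norm 2 f)\<^sup>2 *
    Re (ntr (mat_adjoint (mat_adjoint h * h) * (mat_adjoint h * h)))"
proof (cases "N = 0")
  case True
  thus ?thesis using f h by (simp add: ntr_def)
next
  case False
  obtain U d where U: "U \<in> carrier_mat N N" "mat_adjoint U * U = 1\<^sub>m N"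
    and fe: "f = U * mat_diag N (\<lambda>i. complex_of_real (d i)) * mat_adjoint U"
    using hermitian_diagonalization[OF f] by blast
  let ?V = "mat_adjoint U" and ?D = "mat_diag N (\<lambda>i. complex_of_real (d i))"
  have V: "?V \<in> carrier_mat N N" by (rule mat_adjoint_carrier[OF U(1)])
  have V1: "mat_adjoint ?V * ?V = 1\<^sub>m N"
    using mat_mult_left_right_inverse[OF V U(1) U(2)] by simp
  have D: "?D \<in> carrier_mat N N" by simp
  \<comment> \<open>the matrix \<open>h\<close> in the eigenbasis of \<open>f\<close>\<close>
  define k where "k = ?V * h * mat_adjoint ?V"
  have k: "k \<in> carrier_mat N N" using U(1) V h by (simp add: k_def)
  have "ntr (mat_adjoint f * h) = ntr (U * (?D * (?V * h)))"
  proof -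
    have "f * h = U * (?D * (?V * h))"
      unfolding fe using U(1) V D h by (simp add: assoc_mult_mat[of _ N N _ N _ N] mult_carrier_mat[of _ N N _ N])
    thus ?thesis by (simp add: f(2))
  qed
  also have "\<dots> = ntr (?D * (?V * h) * U)"
    by (rule ntr_mult_commute[OF U(1) mult_carrier_mat[OF D mult_carrier_mat[OF V h]]])
  also have "?D * (?V * h) * U = ?D * k"
    using U(1) V D h by (simp add: k_def assoc_mult_mat[of _ N N _ N _ N] mult_carrier_mat[of _ N N _ N])
  finally have tr: "ntr (mat_adjoint f * h) = (\<Sum>i<N. of_real (d i) * k $$ (i, i)) / of_nat N"
    using ntr_mat_diag_mult[OF k] by simp
  let ?hh = "mat_adjoint h * h" and ?kk = "mat_adjoint k * k"
  have h': "mat_adjoint h \<in> carrier_mat N N" by (rule mat_adjoint_carrier[OF h])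
  have hh: "?hh \<in> carrier_mat N N" by (rule mult_carrier_mat[OF h' h])
  have hh': "mat_adjoint ?hh \<in> carrier_mat N N" by (rule mat_adjoint_carrier[OF hh])
  have kk: "?kk = ?V * ?hh * mat_adjoint ?V"
    unfolding k_def unitary_conj_adjoint[OF V h] by (rule unitary_conj_mult[OF V V1 h' h])
  have "mat_adjoint ?kk * ?kk = ?V * (mat_adjoint ?hh * ?hh) * mat_adjoint ?V"
    unfolding kk unitary_conj_adjoint[OF V hh] by (rule unitary_conj_mult[OF V V1 hh' hh])
  hence "ntr (mat_adjoint ?kk * ?kk) = ntr (mat_adjoint ?hh * ?hh)"
    using ntr_unitary_conj[OF V V1 mult_carrier_mat[OF hh' hh]] by simp
  hence fourth: "(\<Sum>i<N. ((cmod (k $$ (i, i)))\<^sup>2)\<^sup>2) / N \<le> Re (ntr (mat_adjoint ?hh * ?hh))"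
    using diagonal_fourth_moment[OF k] by simp
  let ?K = "\<lambda>i. cmod (k $$ (i, i))"
  let ?S = "\<Sum>i<N. \<bar>d i\<bar> * ?K i"
  have "cmod (ntr (mat_adjoint f * h)) \<le> ?S / N"
    unfolding tr norm_divide norm_of_nat
    by (intro divide_right_mono sum_norm_le) (auto simp: norm_mult)
  hence "((cmod (ntr (mat_adjoint f * h)))\<^sup>2)\<^sup>2 \<le> ((?S / N)\<^sup>2)\<^sup>2"
    by (intro power_mono) auto
  also have "\<dots> \<le> ((\<Sum>i<N. \<bar>d i\<bar>) / N)\<^sup>2 * ((\<Sum>i<N. (d i)\<^sup>2) / N) * ((\<Sum>i<N. ((?K i)\<^sup>2)\<^sup>2) / N)"
  proof -
    have "?S\<^sup>2 = (\<Sum>i<N. sqrt \<bar>d i\<bar> * (sqrt \<bar>d i\<bar> * ?K i))\<^sup>2"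
      by (simp flip: mult.assoc)
    also have "\<dots> \<le> (\<Sum>i<N. \<bar>d i\<bar>) * (\<Sum>i<N. \<bar>d i\<bar> * (?K i)\<^sup>2)"
      using cauchy_schwarz_sum_square[of "\<lambda>i. sqrt \<bar>d i\<bar>" "\<lambda>i. sqrt \<bar>d i\<bar> * ?K i" "{..<N}"] by (simp add: power_mult_distrib)
    finally have "(?S\<^sup>2)\<^sup>2 \<le> ((\<Sum>i<N. \<bar>d i\<bar>) * (\<Sum>i<N. \<bar>d i\<bar> * (?K i)\<^sup>2))\<^sup>2"
      by (intro power_mono) auto
    also have "\<dots> = (\<Sum>i<N. \<bar>d i\<bar>)\<^sup>2 * (\<Sum>i<N. \<bar>d i\<bar> * (?K i)\<^sup>2)\<^sup>2"
      by (rule power_mult_distrib)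
    also have "\<dots> \<le> (\<Sum>i<N. \<bar>d i\<bar>)\<^sup>2 * ((\<Sum>i<N. (d i)\<^sup>2) * (\<Sum>i<N. ((?K i)\<^sup>2)\<^sup>2))"
      using cauchy_schwarz_sum_square[of "\<lambda>i. \<bar>d i\<bar>" "\<lambda>i. (?K i)\<^sup>2""{..<N}"] by (intro mult_left_mono) simp_all
    finally have "(?S\<^sup>2)\<^sup>2 / real N ^ 4 \<le> (\<Sum>i<N. \<bar>d i\<bar>)\<^sup>2 * ((\<Sum>i<N. (d i)\<^sup>2) * (\<Sum>i<N. ((?K i)\<^sup>2)\<^sup>2)) / real N ^ 4"
      by (rule divide_right_mono) simp
    thus ?thesis by (simp add: power_divide power_mult_distrib mult_ac flip: power_mult power_add power_Suc)
  qed
  also have "\<dots> \<le> ((\<Sum>i<N. \<bar>d i\<bar>) / N)\<^sup>2 * ((\<Sum>i<N. (d i)\<^sup>2) / N) * Re (ntr (mat_adjoint ?hh * ?hh))"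
    using fourth by (intro mult_left_mono) (auto intro!: mult_nonneg_nonneg divide_nonneg_nonneg sum_nonneg)
  finally show ?thesis
    unfolding lp_norm_one_diagonalized[OF U fe] lp_norm_two_diagonalized[OF U fe] .
qed


section \<open>Hypercontractivity on elementary abelian 2-groups\<close>

text \<open>
  Every element is its own inverse, so \<open>f r\<close> is an involution of the carrier and
  \<open>f r r\<close> is the neutral element.
\<close>

definition elem_two_group :: "'i set \<Rightarrow> ('i \<Rightarrow> 'i \<Rightarrow> 'i) \<Rightarrow> bool" where
  "elem_two_group I f \<longleftrightarrow> finite I \<and> (\<forall>r\<in>I. \<forall>s\<in>I. f r s \<in> I \<and> f r s = f s r \<and> f r (f r s) = s \<and>
     (\<forall>t\<in>I. f (f r s) t = f r (f s t)))"

lemma elem_two_groupD: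
  assumes "elem_two_group I f"
  shows "finite I" "r \<in> I \<Longrightarrow> s \<in> I \<Longrightarrow> f r s \<in> I" "r \<in> I \<Longrightarrow> s \<in> I \<Longrightarrow> f r s = f s r"
    "r \<in> I \<Longrightarrow> s \<in> I \<Longrightarrow> f r (f r s) = s" 
    "r \<in> I \<Longrightarrow> s \<in> I \<Longrightarrow> t \<in> I \<Longrightarrow> f (f r s) t = f r (f s t)"
  using assms unfolding elem_two_group_def by blast+

lemma sum_translate:
  assumes "elem_two_group I f" "r \<in> I"
  shows "(\<Sum>t\<in>I. h t) = (\<Sum>v\<in>I. h (f r v))"
  using assms(2) elem_two_groupD(2,4)[OF assms(1)]
  by (intro sum.reindex_bij_witness[of _ "f r" "f r"]) auto

definition xcorr :: "'i set \<Rightarrow> ('i \<Rightarrow> 'i \<Rightarrow> 'i) \<Rightarrow> ('i \<Rightarrow> real) \<Rightarrow> ('i \<Rightarrow> real) \<Rightarrow> 'i \<Rightarrow> real" where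
  "xcorr I f a b s = (\<Sum>r\<in>I. a r * b (f r s))"

text \<open>
  For Fourier transforms on the group this is \<open>\<integral> F\<^sup>2 G\<^sup>2 \<le>
  (\<integral> F\<^sup>4)\<^bsup>1/2\<^esup> (\<integral> G\<^sup>4)\<^bsup>1/2\<^esup>\<close>.
  On the group side, the left-hand side is a sum over all quadruples with trivial product, and
  regrouping the quadruples turns it into the inner product of two autocorrelations.
\<close>

lemma xcorr_cauchy_schwarz:
  assumes G: "elem_two_group I f"
  shows "(\<Sum>s\<in>I. (xcorr I f a b s)\<^sup>2) \<le>
    sqrt (\<Sum>s\<in>I. (xcorr I f a a s)\<^sup>2) * sqrt (\<Sum>s\<in>I. (xcorr I f b b s)\<^sup>2)"
proof -
  note g = elem_two_groupD[OF G]
  have "(\<Sum>s\<in>I. (xcorr I f a b s)\<^sup>2) = (\<Sum>s\<in>I. \<Sum>r\<in>I. \<Sum>t\<in>I. a r * b (f r s) * (a t * b (f t s)))"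
    by (simp add: xcorr_def power2_eq_square sum_product)
  also have "\<dots> = (\<Sum>s\<in>I. \<Sum>r\<in>I. \<Sum>v\<in>I. a r * b (f r s) * (a (f r v) * b (f (f r v) s)))"
    by (intro sum.cong refl sum_translate[OF G])
  also have "\<dots> = (\<Sum>r\<in>I. \<Sum>v\<in>I. \<Sum>s\<in>I. a r * b (f r s) * (a (f r v) * b (f (f r v) s)))"
    by (subst sum.swap) (intro sum.cong refl sum.swap)
  also have "\<dots> = (\<Sum>r\<in>I. \<Sum>v\<in>I. \<Sum>q\<in>I. a r * b (f r (f r q)) * (a (f r v) * b (f (f r v) (f r q))))"
    by (intro sum.cong refl sum_translate[OF G])
  also have "\<dots> = (\<Sum>r\<in>I. \<Sum>v\<in>I. \<Sum>q\<in>I. (a r * a (f r v)) * (b q * b (f q v)))"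
  proof (intro sum.cong refl)
    fix r v q assume *: "r \<in> I" "v \<in> I" "q \<in> I"
    have "f (f r v) (f r q) = f (f v r) (f r q)" using * g(3) by simp
    also have "\<dots> = f v q" using * g by simp
    also have "\<dots> = f q v" using * g(3) by simp
    finally show "a r * b (f r (f r q)) * (a (f r v) * b (f (f r v) (f r q))) = a r * a (f r v) * (b q * b (f q v))"
      using * g(4) by simp
  qed
  also have "\<dots> = (\<Sum>v\<in>I. xcorr I f a a v * xcorr I f b b v)"
    by (subst sum.swap) (simp add: xcorr_def sum_product)
  also have "\<dots> \<le> sqrt (\<Sum>s\<in>I. (xcorr I f a a s)\<^sup>2) * sqrt (\<Sum>s\<in>I. (xcorr I f b b s)\<^sup>2)"
    by (rule cauchy_schwarz_sum)
  finally show ?thesis .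
qed

text \<open>
  The triangle inequality for the Euclidean norm.
\<close>

lemma sum_squares_triangle:
  fixes X :: "'i \<Rightarrow> 'j \<Rightarrow> real"
  assumes X: "\<And>i. i \<in> I \<Longrightarrow> (\<Sum>s\<in>J. (X i s)\<^sup>2) \<le> (c i)\<^sup>2"
    and c: "\<And>i. i \<in> I \<Longrightarrow> c i \<ge> 0"
  shows "(\<Sum>s\<in>J. (\<Sum>i\<in>I. X i s)\<^sup>2) \<le> (\<Sum>i\<in>I. c i)\<^sup>2"
proof -
  have "(\<Sum>s\<in>J. (\<Sum>i\<in>I. X i s)\<^sup>2) = (\<Sum>i\<in>I. \<Sum>j\<in>I. \<Sum>s\<in>J. X i s * X j s)"
    by (simp add: power2_eq_square sum_product, subst sum.swap, intro sum.cong refl sum.swap)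
  also have "\<dots> \<le> (\<Sum>i\<in>I. \<Sum>j\<in>I. c i * c j)"
  proof (intro sum_mono)
    fix i j assume ij: "i \<in> I" "j \<in> I"
    have "(\<Sum>s\<in>J. X i s * X j s) \<le> sqrt (\<Sum>s\<in>J. (X i s)\<^sup>2) * sqrt (\<Sum>s\<in>J. (X j s)\<^sup>2)"
      by (rule cauchy_schwarz_sum)
    also have "\<dots> \<le> c i * c j"
      using ij X c by (intro mult_mono real_le_lsqrt) (auto intro: sum_nonneg)
    finally show "(\<Sum>s\<in>J. X i s * X j s) \<le> c i * c j" .
  qed
  finally show ?thesis by (simp add: power2_eq_square sum_product)
qed

text \<open>
  For \<open>F = \<Sum> b\<^sub>r \<chi>\<^sub>r\<close>, a combination of characters, this says
  that the multiplier \<open>w\<close> maps \<open>L\<^sub>2\<close> to \<open>L\<^sub>4\<close>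
  with norm at most 1: the sum of the squared autocorrelations is the integral of the fourth power
  of \<open>\<Sum> w\<^sub>r b\<^sub>r \<chi>\<^sub>r\<close>. Only nonnegative coefficients are
  considered, which is the worst case.
\<close>

definition hypercontractive :: "'i set \<Rightarrow> ('i \<Rightarrow> 'i \<Rightarrow> 'i) \<Rightarrow> ('i \<Rightarrow> real) \<Rightarrow> bool" where
  "hypercontractive I f w \<longleftrightarrow> (\<forall>b. (\<forall>r\<in>I. 0 \<le> b r) \<longrightarrow>
     (\<Sum>s\<in>I. (xcorr I f (\<lambda>r. w r * b r) (\<lambda>r. w r * b r) s)\<^sup>2) \<le> (\<Sum>r\<in>I. (b r)\<^sup>2)\<^sup>2)"

lemma hypercontractiveD:
  "hypercontractive I f w \<Longrightarrow> (\<And>r. r \<in> I \<Longrightarrow> 0 \<le> b r) \<Longrightarrow>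
     (\<Sum>s\<in>I. (xcorr I f (\<lambda>r. w r * b r) (\<lambda>r. w r * b r) s)\<^sup>2) \<le> (\<Sum>r\<in>I. (b r)\<^sup>2)\<^sup>2"
  unfolding hypercontractive_def by blast

definition pair_op :: "('i \<Rightarrow> 'i \<Rightarrow> 'i) \<Rightarrow> ('j \<Rightarrow> 'j \<Rightarrow> 'j) \<Rightarrow> 'i \<times> 'j \<Rightarrow> 'i \<times> 'j \<Rightarrow> 'i \<times> 'j" where
  "pair_op f g p q = (f (fst p) (fst q), g (snd p) (snd q))"

text \<open>
  Slice a function on the product along the first factor. The triangle inequality and
  \<open>xcorr_cauchy_schwarz\<close> reduce the fourth moment on the product to the fourth
  moment, on the first factor, of the function \<open>i \<mapsto> v\<^sub>i B\<^sub>i\<close>,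
  where \<open>B\<^sub>i\<close> is the Euclidean norm of the \<open>i\<close>-th slice;
  hypercontractivity of the second factor bounds the slices by \<open>B\<^sub>i\<close>.
\<close>

lemma hypercontractive_tensor:
  assumes I: "elem_two_group I f" and J: "elem_two_group J g"
    and HI: "hypercontractive I f v" and HJ: "hypercontractive J g w"
    and v: "\<And>i. i \<in> I \<Longrightarrow> 0 \<le> v i"
  shows "hypercontractive (I \<times> J) (pair_op f g) (\<lambda>p. v (fst p) * w (snd p))"
  unfolding hypercontractive_def
proof (intro allI impI)
  fix b :: "'a \<times> 'b \<Rightarrow> real" assume b: "\<forall>r\<in>I \<times> J. 0 \<le> b r"
  note gI = elem_two_groupD[OF I]
  let ?A = "\<lambda>i r. w r * (v i * b (i, r))"
  let ?B = "\<lambda>i. sqrt (\<Sum>r\<in>J. (b (i, r))\<^sup>2)"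
  have B0: "?B i \<ge> 0" for i by (simp add: sum_nonneg)
  have N: "sqrt (\<Sum>s\<in>J. (xcorr J g (?A i) (?A i) s)\<^sup>2) \<le> (v i * ?B i)\<^sup>2" if i: "i \<in> I" for i
  proof -
    have "(\<Sum>s\<in>J. (xcorr J g (?A i) (?A i) s)\<^sup>2) \<le> (\<Sum>r\<in>J. (v i * b (i, r))\<^sup>2)\<^sup>2"
      using i b v by (intro hypercontractiveD[OF HJ]) auto
    also have "(\<Sum>r\<in>J. (v i * b (i, r))\<^sup>2) = (v i * ?B i)\<^sup>2"
      by (simp add: power_mult_distrib sum_distrib_left sum_nonneg)
    finally show ?thesis by (intro real_le_lsqrt) (auto intro: sum_nonneg)
  qed
  have X: "(\<Sum>s\<in>J. (xcorr J g (?A i) (?A (f i u)) s)\<^sup>2) \<le> ((v i * ?B i) * (v (f i u) * ?B (f i u)))\<^sup>2"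
    if "i \<in> I" "u \<in> I" for i u
  proof -
    have "(\<Sum>s\<in>J. (xcorr J g (?A i) (?A (f i u)) s)\<^sup>2) \<le>
      sqrt (\<Sum>s\<in>J. (xcorr J g (?A i) (?A i) s)\<^sup>2) * sqrt (\<Sum>s\<in>J. (xcorr J g (?A (f i u)) (?A (f i u)) s)\<^sup>2)"
      by (rule xcorr_cauchy_schwarz[OF J])
    also have "\<dots> \<le> (v i * ?B i)\<^sup>2 * (v (f i u) * ?B (f i u))\<^sup>2"
      using that gI(2) by (intro mult_mono N) (auto intro: sum_nonneg)
    finally show ?thesis by (simp add: power_mult_distrib)
  qed
  let ?a = "\<lambda>r. v (fst r) * w (snd r) * b r"
  have "(\<Sum>s\<in>I \<times> J. (xcorr (I \<times> J) (pair_op f g) ?a ?a s)\<^sup>2) =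
    (\<Sum>u\<in>I. \<Sum>s\<in>J. (\<Sum>i\<in>I. xcorr J g (?A i) (?A (f i u)) s)\<^sup>2)"
    by (simp add: xcorr_def pair_op_def sum.cartesian_product' mult_ac)
  also have "\<dots> \<le> (\<Sum>u\<in>I. (\<Sum>i\<in>I. (v i * ?B i) * (v (f i u) * ?B (f i u)))\<^sup>2)"
  proof (intro sum_mono sum_squares_triangle)
    fix u i assume "u \<in> I" "i \<in> I"
    thus "0 \<le> v i * ?B i * (v (f i u) * ?B (f i u))"
      using v gI(2)[of i u] B0 by simp
  qed (use X in auto)
  also have "\<dots> = (\<Sum>u\<in>I. (xcorr I f (\<lambda>i. v i * ?B i) (\<lambda>i. v i * ?B i) u)\<^sup>2)"
    by (simp add: xcorr_def)
  also have "\<dots> \<le> (\<Sum>i\<in>I. (?B i)\<^sup>2)\<^sup>2"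
    by (rule hypercontractiveD[OF HI B0])
  also have "\<dots> = (\<Sum>r\<in>I \<times> J. (b r)\<^sup>2)\<^sup>2"
    by (simp add: sum_nonneg sum.cartesian_product)
  finally show "(\<Sum>s\<in>I \<times> J. (xcorr (I \<times> J) (pair_op f g) ?a ?a s)\<^sup>2) \<le> (\<Sum>r\<in>I \<times> J. (b r)\<^sup>2)\<^sup>2" .
qed

text \<open>
  The inequality holds for weights up to \<open>1 / sqrt 3\<close>; the value \<open>1 / 2\<close>
  keeps the numbers rational.
\<close>

lemma hypercontractive_two_point:
  "hypercontractive UNIV (\<noteq>) (\<lambda>i. if i then 1 / 2 else 1)"
  unfolding hypercontractive_def
proof (intro allI impI)
  fix b :: "bool \<Rightarrow> real"
  define x y where "x = b False" and "y = b True"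
  have "(x\<^sup>2 + (y / 2)\<^sup>2)\<^sup>2 + (x * (y / 2) + x * (y / 2))\<^sup>2 \<le> (x\<^sup>2 + y\<^sup>2)\<^sup>2"
  proof -
    have "(x\<^sup>2 + y\<^sup>2)\<^sup>2 - ((x\<^sup>2 + (y / 2)\<^sup>2)\<^sup>2 + (x * (y / 2) + x * (y / 2))\<^sup>2) = (x * y)\<^sup>2 / 2 + 15 / 16 * (y\<^sup>2)\<^sup>2"
      by (simp add: power2_eq_square field_simps)
    moreover have "(x * y)\<^sup>2 / 2 + 15 / 16 * (y\<^sup>2)\<^sup>2 \<ge> 0" by simp
    ultimately show ?thesis by linarith
  qed
  thus "(\<Sum>s\<in>UNIV. (xcorr UNIV (\<noteq>) (\<lambda>i. (if i then 1 / 2 else 1) * b i)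
    (\<lambda>i. (if i then 1 / 2 else 1) * b i) s)\<^sup>2) \<le> (\<Sum>r\<in>UNIV. (b r)\<^sup>2)\<^sup>2"
    by (simp add: xcorr_def UNIV_bool x_def y_def power2_eq_square algebra_simps)
qed

lemma hypercontractive_transport:
  assumes "hypercontractive I f w" and bij: "bij_betw \<phi> K I"
    and hom: "\<And>r s. r \<in> K \<Longrightarrow> s \<in> K \<Longrightarrow> h r s \<in> K \<and> \<phi> (h r s) = f (\<phi> r) (\<phi> s)"
  shows "hypercontractive K h (\<lambda>r. w (\<phi> r))"
  unfolding hypercontractive_def
proof (intro allI impI)
  fix b :: "'b \<Rightarrow> real" assume b: "\<forall>r\<in>K. 0 \<le> b r"
  define b' where "b' i = b (inv_into K \<phi> i)" for i
  have inj: "inj_on \<phi> K" using bij by (simp add: bij_betw_def)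
  have b': "b' (\<phi> r) = b r" if "r \<in> K" for r using that inj by (simp add: b'_def)
  have re: "(\<Sum>i\<in>I. F i) = (\<Sum>r\<in>K. F (\<phi> r))" for F :: "'a \<Rightarrow> real"
    using sum.reindex_bij_betw[OF bij] by metis
  have "0 \<le> b' i" if "i \<in> I" for i
    using that b bij b' unfolding bij_betw_def by auto
  from hypercontractiveD[OF assms(1), of b', OF this]
  have "(\<Sum>s\<in>I. (xcorr I f (\<lambda>r. w r * b' r) (\<lambda>r. w r * b' r) s)\<^sup>2) \<le> (\<Sum>r\<in>I. (b' r)\<^sup>2)\<^sup>2" .
  moreover have "xcorr I f (\<lambda>r. w r * b' r) (\<lambda>r. w r * b' r) (\<phi> s) =
      xcorr K h (\<lambda>r. w (\<phi> r) * b r) (\<lambda>r. w (\<phi> r) * b r) s" if "s \<in> K" for s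
    unfolding xcorr_def re
  proof (intro sum.cong refl)
    fix r assume "r \<in> K"
    with hom[OF this that] b'[of "h r s"] b'[of r]
    show "w (\<phi> r) * b' (\<phi> r) * (w (f (\<phi> r) (\<phi> s)) * b' (f (\<phi> r) (\<phi> s))) =
      w (\<phi> r) * b r * (w (\<phi> (h r s)) * b (h r s))" by simp
  qed
  ultimately show "(\<Sum>s\<in>K. (xcorr K h (\<lambda>r. w (\<phi> r) * b r) (\<lambda>r. w (\<phi> r) * b r) s)\<^sup>2) \<le> (\<Sum>r\<in>K. (b r)\<^sup>2)\<^sup>2"
    by (simp add: re b')
qed

lemma xor_less_two_power: "r < 2 ^ n \<Longrightarrow> s < 2 ^ n \<Longrightarrow> xor r s < (2::nat) ^ n"
  by (metis take_bit_nat_eq_self_iff take_bit_xor)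

lemma elem_two_group_xor: "elem_two_group {..<2 ^ n} (xor :: nat \<Rightarrow> nat \<Rightarrow> nat)"
proof -
  have "xor r (xor r s) = s" for r s :: nat by (simp flip: xor.assoc)
  thus ?thesis
    unfolding elem_two_group_def by (auto simp: xor_less_two_power xor.assoc intro: xor.commute)
qed

definition bit_weight :: "nat \<Rightarrow> nat \<Rightarrow> real" where
  "bit_weight n r = (\<Prod>k<n. if bit r k then 1 / 2 else 1)"

text \<open>
  Splitting off the lowest bit identifies \<open>{..<2 ^ Suc n}\<close> with a two-point group
  times \<open>{..<2 ^ n}\<close>.
\<close>

lemma hypercontractive_xor: "hypercontractive {..<2 ^ n} xor (bit_weight n)"
proof (induction n)
  case 0
  show ?case
    by (simp add: hypercontractive_def xcorr_def bit_weight_def power2_eq_square lessThan_Suc)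
next
  case (Suc n)
  let ?\<phi> = "\<lambda>r::nat. (odd r, r div 2)"
  have U: "elem_two_group UNIV (\<noteq>)" by (auto simp: elem_two_group_def)
  have "hypercontractive {..<2 ^ Suc n} xor
     (\<lambda>r. (\<lambda>p. (if fst p then 1 / 2 else 1) * bit_weight n (snd p)) (?\<phi> r))"
  proof (rule hypercontractive_transport[OF hypercontractive_tensor[OF U elem_two_group_xor
        hypercontractive_two_point Suc.IH]])
    show "bij_betw ?\<phi> {..<2 ^ Suc n} (UNIV \<times> {..<2 ^ n})"
    proof (rule bij_betw_byWitness[where f' = "\<lambda>(c, q). of_bool c + 2 * q"])
    qed auto
    fix r s :: nat assume "r \<in> {..<2 ^ Suc n}" "s \<in> {..<2 ^ Suc n}"
    thus "xor r s \<in> {..<2 ^ Suc n} \<and> ?\<phi> (xor r s) = pair_op (\<noteq>) xor (?\<phi> r) (?\<phi> s)"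
      using xor_less_two_power[of r "Suc n" s] drop_bit_xor[of 1 r s]
      by (auto simp: pair_op_def even_xor_iff drop_bit_eq_div)
  qed auto
  moreover have "(\<lambda>r. (\<lambda>p. (if fst p then 1 / 2 else 1) * bit_weight n (snd p)) (?\<phi> r)) = bit_weight (Suc n)"
    by (rule ext) (simp add: bit_weight_def prod.lessThan_Suc_shift bit_0 bit_Suc del: prod.lessThan_Suc)
  ultimately show ?case by simp
qed


section \<open>The Pauli expansion\<close>

text \<open>
  The character of \<open>{..<2 ^ n}\<close> under \<open>xor\<close> that belongs to
  \<open>z\<close>.
\<close>

definition walsh :: "nat \<Rightarrow> nat \<Rightarrow> nat \<Rightarrow> complex" where
  "walsh n z r = (\<Prod>k<n. if bit z k \<and> bit r k then - 1 else 1)"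

lemma walsh_xor: "walsh n z (xor r s) = walsh n z r * walsh n z s"
  unfolding walsh_def prod.distrib[symmetric]
  by (intro prod.cong) (auto simp: bit_xor_iff)

lemma walsh_commute: "walsh n z r = walsh n r z"
  by (simp add: walsh_def conj_commute)

lemma walsh_xor_left: "walsh n (xor y z) r = walsh n y r * walsh n z r"
  by (simp add: walsh_commute[of n _ r] walsh_xor)

lemma walsh_self [simp]: "walsh n z r * walsh n z r = 1"
  unfolding walsh_def prod.distrib[symmetric] by (intro prod.neutral) auto

lemma walsh_cnj [simp]: "cnj (walsh n z r) = walsh n z r"
  unfolding walsh_def cnj_prod by (intro prod.cong) auto

lemma walsh_norm [simp]: "cmod (walsh n z r) = 1"
  unfolding walsh_def prod_norm[symmetric] by (intro prod.neutral) auto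

lemma walsh_zero [simp]: "walsh n 0 r = 1"
  unfolding walsh_def by (intro prod.neutral) auto

lemma walsh_two_power:
  assumes "k < n"
  shows "walsh n z (2 ^ k) = (if bit z k then - 1 else 1)"
proof -
  have "walsh n z (2 ^ k) = (\<Prod>j<n. if k = j then (if bit z k then - 1 else 1) else 1)"
    unfolding walsh_def by (intro prod.cong) (auto simp: bit_exp_iff)
  thus ?thesis using assms by simp
qed

lemma sum_xor_translate:
  fixes h :: "nat \<Rightarrow> 'a :: comm_monoid_add"
  shows "s < 2 ^ n \<Longrightarrow> (\<Sum>r<2 ^ n. h (xor s r)) = (\<Sum>r<2 ^ n. h r)"
  using sum_translate[OF elem_two_group_xor, of s n h] by simp

lemma ex_bit_below:
  assumes "x < 2 ^ n" "x \<noteq> (0::nat)"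
  shows "\<exists>k<n. bit x k"
proof (rule ccontr)
  assume "\<not> (\<exists>k<n. bit x k)"
  hence "take_bit n x = 0" by (intro bit_eqI) (auto simp: bit_take_bit_iff)
  thus False using assms by (simp add: take_bit_nat_eq_self)
qed

text \<open>
  Translation by \<open>2 ^ k\<close> preserves the sum but changes the sign of the character if
  \<open>z\<close> has the bit \<open>k\<close>.
\<close>

lemma walsh_sum:
  assumes "z < 2 ^ n"
  shows "(\<Sum>r<2 ^ n. walsh n z r) = (if z = 0 then 2 ^ n else 0)"
proof (cases "z = 0")
  case False
  then obtain k where k: "k < n" "bit z k" using ex_bit_below[OF assms] by blast
  have "(\<Sum>r<2 ^ n. walsh n z r) = (\<Sum>r<2 ^ n. walsh n z (xor (2 ^ k) r))"
    using k(1) by (intro sum_xor_translate[symmetric]) simp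
  also have "\<dots> = - (\<Sum>r<2 ^ n. walsh n z r)"
    using k by (simp add: walsh_xor walsh_two_power sum_negf)
  finally show ?thesis using False by simp
qed simp

lemma walsh_orthogonal:
  assumes "y < 2 ^ n" "z < 2 ^ n"
  shows "(\<Sum>r<2 ^ n. walsh n y r * walsh n z r) = (if y = z then 2 ^ n else 0)"
proof -
  have "xor y z = 0 \<longleftrightarrow> y = z"
    by (metis xor.assoc xor.right_neutral xor_self_eq xor.left_neutral)
  thus ?thesis
    using walsh_sum[OF xor_less_two_power[OF assms]] by (simp add: walsh_xor_left)
qed

definition walsh_transform :: "nat \<Rightarrow> (nat \<Rightarrow> complex) \<Rightarrow> nat \<Rightarrow> complex" where
  "walsh_transform n f z = (\<Sum>r<2 ^ n. walsh n z r * f r) / 2 ^ n"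

lemma walsh_transform_inversion:
  assumes "r < 2 ^ n"
  shows "(\<Sum>z<2 ^ n. walsh n z r * walsh_transform n f z) = f r"
proof -
  have "(\<Sum>z<2 ^ n. walsh n z r * walsh_transform n f z) =
    (\<Sum>z<2 ^ n. \<Sum>s<2 ^ n. walsh n r z * walsh n s z * f s) / 2 ^ n"
    by (simp add: walsh_transform_def sum_divide_distrib sum_distrib_left walsh_commute mult_ac)
  also have "\<dots> = (\<Sum>s<2 ^ n. (\<Sum>z<2 ^ n. walsh n r z * walsh n s z) * f s) / 2 ^ n"
    by (subst sum.swap) (simp add: sum_distrib_right)
  also have "\<dots> = (\<Sum>s<2 ^ n. if r = s then 2 ^ n * f s else 0) / 2 ^ n"
    using assms by (intro arg_cong2[of _ _ _ _ "(/)"] sum.cong refl) (simp add: walsh_orthogonal)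
  also have "\<dots> = f r" using assms by simp
  finally show ?thesis .
qed

lemma walsh_transform_synthesis:
  assumes "z < 2 ^ n"
  shows "walsh_transform n (\<lambda>r. \<Sum>y<2 ^ n. walsh n y r * a y) z = a z"
proof -
  have "walsh_transform n (\<lambda>r. \<Sum>y<2 ^ n. walsh n y r * a y) z =
    (\<Sum>r<2 ^ n. walsh n r z * walsh_transform n a r)"
    unfolding walsh_transform_def
    by (simp add: walsh_commute sum_divide_distrib sum_distrib_left)
  thus ?thesis using walsh_transform_inversion[OF assms] by simp
qed

lemma walsh_parseval:
  "(\<Sum>z<2 ^ n. cnj (walsh_transform n f z) * walsh_transform n g z) = (\<Sum>r<2 ^ n. cnj (f r) * g r) / 2 ^ n"
proof -
  have "(\<Sum>z<2 ^ n. cnj (walsh_transform n f z) * walsh_transform n g z) =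
    (\<Sum>z<2 ^ n. \<Sum>r<2 ^ n. cnj (f r) * (walsh n z r * walsh_transform n g z)) / 2 ^ n"
    by (simp add: walsh_transform_def[of n f] sum_divide_distrib sum_distrib_left sum_distrib_right mult_ac)
  also have "\<dots> = (\<Sum>r<2 ^ n. cnj (f r) * (\<Sum>z<2 ^ n. walsh n z r * walsh_transform n g z)) / 2 ^ n"
    by (subst sum.swap) (simp add: sum_distrib_left)
  also have "\<dots> = (\<Sum>r<2 ^ n. cnj (f r) * g r) / 2 ^ n"
    by (simp add: walsh_transform_inversion)
  finally show ?thesis .
qed

lemma walsh_transform_translate:
  assumes "s < 2 ^ n"
  shows "walsh_transform n (\<lambda>r. f (xor s r)) z = walsh n z s * walsh_transform n f z"
proof -
  have "(\<Sum>r<2 ^ n. walsh n z r * f r) = (\<Sum>r<2 ^ n. walsh n z (xor s r) * f (xor s r))"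
    by (rule sum_xor_translate[OF assms, symmetric])
  also have "\<dots> = walsh n z s * (\<Sum>r<2 ^ n. walsh n z r * f (xor s r))"
    by (simp add: walsh_xor sum_distrib_left mult_ac)
  finally have "walsh n z s * (\<Sum>r<2 ^ n. walsh n z r * f r) =
      (walsh n z s * walsh n z s) * (\<Sum>r<2 ^ n. walsh n z r * f (xor s r))"
    by simp
  thus ?thesis by (simp add: walsh_transform_def)
qed

lemma walsh_transform_modulate:
  "walsh_transform n (\<lambda>r. walsh n y r * f r) z = walsh_transform n f (xor z y)"
  by (simp add: walsh_transform_def walsh_xor_left mult_ac)

text \<open>
  For \<open>w = (x, z)\<close> this is the coefficient of the signed permutation matrix whose
  only nonzero entries are \<open>walsh n z r\<close> at the positions \<open>(r, xor r
  x)\<close>, that is, of a tensor product of Pauli matrices up to phase: the entries on the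
  generalized diagonal given by \<open>x\<close> are Walsh-transformed.
\<close>

definition pauli_coeff :: "nat \<Rightarrow> complex mat \<Rightarrow> nat \<times> nat \<Rightarrow> complex" where
  "pauli_coeff n M w = walsh_transform n (\<lambda>r. M $$ (r, xor r (fst w))) (snd w)"

abbreviation pauli_words :: "nat \<Rightarrow> (nat \<times> nat) set" where
  "pauli_words n \<equiv> {..<2 ^ n} \<times> {..<2 ^ n}"

abbreviation pauli_mult :: "nat \<times> nat \<Rightarrow> nat \<times> nat \<Rightarrow> nat \<times> nat" where
  "pauli_mult \<equiv> pair_op xor xor"

lemma pauli_parseval:
  assumes A: "A \<in> carrier_mat (2 ^ n) (2 ^ n)" and B: "B \<in> carrier_mat (2 ^ n) (2 ^ n)"
  shows "ntr (mat_adjoint A * B) = (\<Sum>w\<in>pauli_words n. cnj (pauli_coeff n A w) * pauli_coeff n B w)"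
proof -
  have "(\<Sum>w\<in>pauli_words n. cnj (pauli_coeff n A w) * pauli_coeff n B w) =
    (\<Sum>x<2 ^ n. \<Sum>r<2 ^ n. cnj (A $$ (r, xor r x)) * B $$ (r, xor r x)) / 2 ^ n"
    by (simp add: sum.cartesian_product' pauli_coeff_def walsh_parseval sum_divide_distrib)
  also have "(\<Sum>x<2 ^ n. \<Sum>r<2 ^ n. cnj (A $$ (r, xor r x)) * B $$ (r, xor r x)) =
    (\<Sum>r<2 ^ n. \<Sum>x<2 ^ n. cnj (A $$ (r, xor r x)) * B $$ (r, xor r x))"
    by (rule sum.swap)
  also have "\<dots> = (\<Sum>r<2 ^ n. \<Sum>c<2 ^ n. cnj (A $$ (r, c)) * B $$ (r, c))"
    by (intro sum.cong refl sum_xor_translate[where h = "\<lambda>c. cnj (A $$ (_, c)) * B $$ (_, c)"]) simp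
  finally show ?thesis by (simp add: ntr_adjoint_mult[OF A B])
qed

lemma ntr_pauli_coeff:
  assumes "A \<in> carrier_mat (2 ^ n) (2 ^ n)"
  shows "ntr A = pauli_coeff n A (0, 0)"
  using assms by (simp add: ntr_def pauli_coeff_def walsh_transform_def)

lemma pauli_synthesis:
  obtains H where "H \<in> carrier_mat (2 ^ n) (2 ^ n)"
    "\<And>w. w \<in> pauli_words n \<Longrightarrow> pauli_coeff n H w = a w"
proof
  let ?H = "mat (2 ^ n) (2 ^ n) (\<lambda>(r, c). \<Sum>z<2 ^ n. walsh n z r * a (xor r c, z))"
  show "?H \<in> carrier_mat (2 ^ n) (2 ^ n)" by simp
  fix w assume "w \<in> pauli_words n"
  then obtain x z where w: "w = (x, z)" "x < 2 ^ n" "z < 2 ^ n" by auto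
  have "walsh_transform n (\<lambda>r. ?H $$ (r, xor r x)) z =
     walsh_transform n (\<lambda>r. \<Sum>y<2 ^ n. walsh n y r * a (x, y)) z"
    unfolding walsh_transform_def using w
    by (intro arg_cong2[of _ _ _ _ "(/)"] sum.cong refl) (simp add: xor_less_two_power flip: xor.assoc)
  thus "pauli_coeff n ?H w = a w"
    using w by (simp add: pauli_coeff_def walsh_transform_synthesis)
qed

text \<open>
  A product of two Pauli words is, up to a sign, the word given by the bitwise sums, so the
  coefficients of \<open>A\<^sup>* B\<close> are correlations twisted by signs. Passing to moduli
  removes the only trace of noncommutativity.
\<close>

lemma pauli_coeff_adjoint_mult:
  assumes A: "A \<in> carrier_mat (2 ^ n) (2 ^ n)" and B: "B \<in> carrier_mat (2 ^ n) (2 ^ n)"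
    and w: "w \<in> pauli_words n"
  shows "cmod (pauli_coeff n (mat_adjoint A * B) w) \<le>
    xcorr (pauli_words n) pauli_mult (\<lambda>v. cmod (pauli_coeff n A v)) (\<lambda>v. cmod (pauli_coeff n B v)) w"
proof -
  obtain x z where [simp]: "w = (x, z)" and xz: "x < 2 ^ n" "z < 2 ^ n" using w by auto
  let ?f = "\<lambda>y k. A $$ (k, xor k y)" and ?g = "\<lambda>y k. B $$ (k, xor k y)"
  have entry: "(mat_adjoint A * B) $$ (r, xor r x) = (\<Sum>k<2 ^ n. cnj (A $$ (k, r)) * B $$ (k, xor r x))"
    if "r < 2 ^ n" for r
    using that xz A B xor_less_two_power[of r n x]
    by (subst index_mult_mat_sum[OF mat_adjoint_carrier[OF A] B]) auto
  have "pauli_coeff n (mat_adjoint A * B) w =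
    (\<Sum>r<2 ^ n. \<Sum>k<2 ^ n. walsh n z r * (cnj (A $$ (k, r)) * B $$ (k, xor r x))) / 2 ^ n"
    by (simp add: pauli_coeff_def walsh_transform_def entry sum_distrib_left)
  also have "(\<Sum>r<2 ^ n. \<Sum>k<2 ^ n. walsh n z r * (cnj (A $$ (k, r)) * B $$ (k, xor r x))) =
    (\<Sum>k<2 ^ n. \<Sum>r<2 ^ n. walsh n z r * (cnj (A $$ (k, r)) * B $$ (k, xor r x)))"
    by (rule sum.swap)
  \<comment> \<open>write the summation index as \<open>r = xor k y\<close>, so that all entries lie on generalized diagonals\<close>
  also have "\<dots> = (\<Sum>k<2 ^ n. \<Sum>y<2 ^ n. walsh n z (xor k y) * (cnj (A $$ (k, xor k y)) * B $$ (k, xor (xor k y) x)))"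
    by (intro sum.cong refl sum_xor_translate[symmetric,
      where h = "\<lambda>r. walsh n z r * (cnj (A $$ (_, r)) * B $$ (_, xor r x))"]) simp
  also have "\<dots> = (\<Sum>y<2 ^ n. \<Sum>k<2 ^ n. walsh n z y * (cnj (?f y k) * (walsh n z k * ?g (xor y x) k)))"
    by (subst sum.swap) (simp add: walsh_xor xor.assoc mult_ac)
  also have "\<dots> / 2 ^ n = (\<Sum>y<2 ^ n. walsh n z y * ((\<Sum>k<2 ^ n. cnj (?f y k) * (walsh n z k * ?g (xor y x) k)) / 2 ^ n))"
    by (simp add: sum_divide_distrib sum_distrib_left)
  also have "\<dots> = (\<Sum>y<2 ^ n. walsh n z y * (\<Sum>b<2 ^ n. cnj (pauli_coeff n A (y, b)) * pauli_coeff n B (xor y x, xor b z)))"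
    unfolding walsh_parseval[symmetric] by (simp add: walsh_transform_modulate pauli_coeff_def)
  finally have eq: "pauli_coeff n (mat_adjoint A * B) w = \<dots>" .
  show ?thesis
    unfolding eq xcorr_def
    by (auto simp: sum.cartesian_product' pair_op_def norm_mult intro!: sum_norm_le)
qed


section \<open>Partial derivatives in the Pauli basis\<close>

text \<open>
  The index arithmetic of \<open>slot_block\<close> with \<open>q = 2 ^ p\<close> in terms of
  bits: replacing the middle digit either reproduces the index or toggles its \<open>p\<close>-th
  bit.
\<close>

lemma bit_toggle_split:
  fixes r p :: nat
  defines "q \<equiv> 2 ^ p"
  shows "(r div (2 * q) * 2 + of_bool (bit r p)) * q + r mod q = r"
    and "(r div (2 * q) * 2 + of_bool (\<not> bit r p)) * q + r mod q = xor r q"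
proof -
  have q: "q > 0" by (simp add: q_def)
  have b: "of_bool (bit r p) = r div q mod 2"
    by (simp add: bit_iff_odd q_def odd_iff_mod_2_eq_one)
  have d: "r div (2 * q) = r div q div 2" by (metis div_mult2_eq mult.commute)
  show 1: "(r div (2 * q) * 2 + of_bool (bit r p)) * q + r mod q = r"
    unfolding b d by simp
  show "(r div (2 * q) * 2 + of_bool (\<not> bit r p)) * q + r mod q = xor r q"
  proof (cases "bit r p")
    case True
    have "r = set_bit p (xor r q)"
      using True unfolding q_def by (auto intro!: bit_eqI simp: bit_xor_iff bit_set_bit_iff bit_exp_iff)
    also have "\<dots> = xor r q + q" using True by (simp add: set_bit_eq q_def bit_xor_iff bit_exp_iff)
    finally have "xor r q = r - q" by simp
    thus ?thesis using 1 True by (simp add: algebra_simps)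
  next
    case False
    have "xor r q = set_bit p r"
      using False unfolding q_def by (auto intro!: bit_eqI simp: bit_xor_iff bit_set_bit_iff bit_exp_iff)
    also have "\<dots> = r + q" using False by (simp add: set_bit_eq q_def)
    finally show ?thesis using 1 False by (simp add: algebra_simps)
  qed
qed

lemma partial_deriv_carrier:
  "M \<in> carrier_mat (2 ^ n) (2 ^ n) \<Longrightarrow> partial_deriv n j M \<in> carrier_mat (2 ^ n) (2 ^ n)"
  by (auto simp: partial_deriv_def tensor_slot_def)

text \<open>
  Where row and column agree in bit \<open>p\<close>, the subtracted partial trace averages
  \<open>M\<close> over the simultaneous flip of this bit in both; elsewhere it vanishes. The
  first tensor factor is the most significant bit, whence \<open>p = n - j\<close>.
\<close>

lemma index_partial_deriv:
  fixes n j :: nat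
  assumes M: "M \<in> carrier_mat (2 ^ n) (2 ^ n)" and rc: "r < 2 ^ n" "c < 2 ^ n"
  defines "p \<equiv> n - j"
  shows "partial_deriv n j M $$ (r, c) = M $$ (r, c) -
    (if bit r p = bit c p then (M $$ (r, c) + M $$ (xor r (2 ^ p), xor c (2 ^ p))) / 2 else 0)"
proof -
  let ?q = "2 ^ p :: nat"
  let ?S = "slot_block ?q M r c"
  have b: "x div ?q mod 2 = of_bool (bit x p)" for x :: nat
    by (simp add: bit_iff_odd odd_iff_mod_2_eq_one)
  have S: "?S \<in> carrier_mat 2 2" by (simp add: slot_block_def)
  have "partial_deriv n j M $$ (r, c) = D2 ?S $$ (of_bool (bit r p), of_bool (bit c p))"
    using M rc by (simp add: partial_deriv_def tensor_slot_def p_def[symmetric] b)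
  also have "\<dots> = ?S $$ (of_bool (bit r p), of_bool (bit c p)) -
     (if bit r p = bit c p then (?S $$ (0, 0) + ?S $$ (1, 1)) / 2 else 0)"
    using S by (auto simp: D2_def ntr_def numeral_2_eq_2)
  also have "?S $$ (of_bool (bit r p), of_bool (bit c p)) = M $$ (r, c)"
    using bit_toggle_split(1)[of r p] bit_toggle_split(1)[of c p] by (simp add: slot_block_def)
  also have "?S $$ (0, 0) + ?S $$ (1, 1) = M $$ (r, c) + M $$ (xor r ?q, xor c ?q)"
    if "bit r p = bit c p"
    using that bit_toggle_split[of r p] bit_toggle_split[of c p]
    by (cases "bit r p") (simp_all add: slot_block_def add.commute)
  hence "(if bit r p = bit c p then (?S $$ (0, 0) + ?S $$ (1, 1)) / 2 else 0) =
     (if bit r p = bit c p then (M $$ (r, c) + M $$ (xor r ?q, xor c ?q)) / 2 else 0)" by simp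
  finally show ?thesis .
qed

lemma partial_deriv_hermitian:
  assumes M: "M \<in> carrier_mat (2 ^ n) (2 ^ n)" and H: "mat_adjoint M = M" and j: "j \<in> {1..n}"
  shows "mat_adjoint (partial_deriv n j M) = partial_deriv n j M"
proof -
  note C = partial_deriv_carrier[OF M, of j]
  have e: "cnj (M $$ (c, r)) = M $$ (r, c)" if "r < 2 ^ n" "c < 2 ^ n" for r c
    using that M index_mat_adjoint[of r M c] by (simp add: H)
  have x: "xor r (2 ^ (n - j)) < 2 ^ n" if "r < 2 ^ n" for r :: nat
    using that j by (intro xor_less_two_power) auto
  show ?thesis
    using C by (intro eq_matI) (auto simp: index_partial_deriv[OF M] e x)
qed

definition in_support :: "nat \<times> nat \<Rightarrow> nat \<Rightarrow> bool" where
  "in_support w p \<longleftrightarrow> bit (fst w) p \<or> bit (snd w) p"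

text \<open>
  The subtracted average over the flip of bit \<open>p\<close> acts on the generalized diagonal of
  \<open>x\<close> only if \<open>x\<close> does not have this bit; there it multiplies the
  coefficient of \<open>(x, z)\<close> by \<open>(1 + s) / 2\<close>, where the sign
  \<open>s\<close> is \<open>-1\<close> exactly if \<open>z\<close> has the bit.
\<close>

lemma pauli_coeff_partial_deriv:
  assumes M: "M \<in> carrier_mat (2 ^ n) (2 ^ n)" and j: "j \<in> {1..n}" and w: "w \<in> pauli_words n"
  shows "pauli_coeff n (partial_deriv n j M) w =
    (if in_support w (n - j) then pauli_coeff n M w else 0)"
proof -
  obtain x z where [simp]: "w = (x, z)" and xz: "x < 2 ^ n" "z < 2 ^ n" using w by auto
  let ?p = "n - j" and ?f = "\<lambda>r. M $$ (r, xor r x)"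
  have p: "?p < n" and p2: "(2::nat) ^ ?p < 2 ^ n" using j by auto
  let ?s = "if bit x ?p then 0 else 1 / 2 :: complex"
  have "pauli_coeff n (partial_deriv n j M) w =
    walsh_transform n (\<lambda>r. ?f r - ?s * (?f r + ?f (xor (2 ^ ?p) r))) z"
    unfolding pauli_coeff_def walsh_transform_def
    using xz xor_less_two_power[of _ n x]
    by (intro arg_cong2[of _ _ _ _ "(/)"] sum.cong refl)
      (auto simp: index_partial_deriv[OF M] bit_xor_iff ac_simps)
  also have "\<dots> = walsh_transform n ?f z - ?s * (walsh_transform n ?f z + walsh_transform n (\<lambda>r. ?f (xor (2 ^ ?p) r)) z)"
    by (simp add: walsh_transform_def sum_subtractf sum.distrib sum_distrib_left diff_divide_distrib add_divide_distrib algebra_simps)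
  also have "walsh_transform n (\<lambda>r. ?f (xor (2 ^ ?p) r)) z = (if bit z ?p then - 1 else 1) * walsh_transform n ?f z"
    using walsh_transform_translate[OF p2, of ?f z] walsh_two_power[OF p, of z] by simp
  finally show ?thesis
    by (simp add: in_support_def pauli_coeff_def)
qed


section \<open>Noise stability of Hermitian matrices\<close>

definition supp_size :: "nat \<Rightarrow> nat \<times> nat \<Rightarrow> nat" where
  "supp_size n w = card {k. k < n \<and> in_support w k}"

lemma supp_size_sum: "supp_size n w = (\<Sum>j\<in>{1..n}. of_bool (in_support w (n - j)))"
proof -
  have "(\<Sum>j\<in>{1..n}. of_bool (in_support w (n - j))) = (\<Sum>k<n. of_bool (in_support w k) :: nat)"
    by (rule sum.reindex_bij_witness[of _ "\<lambda>k. n - k" "\<lambda>j. n - j"]) auto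
  also have "\<dots> = supp_size n w"
    by (simp add: supp_size_def sum.If_cases of_bool_def Int_def)
  finally show ?thesis ..
qed

lemma supp_size_pos:
  assumes "w \<in> pauli_words n" "w \<noteq> (0, 0)"
  shows "supp_size n w \<ge> 1"
proof -
  from ex_bit_below[of "fst w" n] ex_bit_below[of "snd w" n] assms
  have "{k. k < n \<and> in_support w k} \<noteq> {}" by (cases w) (auto simp: in_support_def)
  thus ?thesis by (simp add: supp_size_def Suc_le_eq card_gt_0_iff)
qed

lemma bit_weight_nonneg: "bit_weight n r \<ge> 0"
  unfolding bit_weight_def by (intro prod_nonneg) auto

text \<open>
  A qubit in the support of \<open>(x, z)\<close> contributes a factor \<open>1 / 2\<close> or
  \<open>1 / 4\<close> to the right-hand side, according to whether one or both of
  \<open>x\<close> and \<open>z\<close> have its bit.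
\<close>

lemma supp_size_weight:
  "(1 / 4) ^ supp_size n w \<le> bit_weight n (fst w) * bit_weight n (snd w)"
proof -
  have "(1 / 4 :: real) ^ supp_size n w = (\<Prod>k<n. if in_support w k then 1 / 4 else 1)"
    by (simp add: supp_size_def prod.If_cases Int_def)
  also have "\<dots> \<le> bit_weight n (fst w) * bit_weight n (snd w)"
    unfolding bit_weight_def prod.distrib[symmetric]
    by (intro prod_mono) (auto simp: in_support_def)
  finally show ?thesis .
qed

lemma hypercontractive_pauli:
  "hypercontractive (pauli_words n) pauli_mult (\<lambda>w. bit_weight n (fst w) * bit_weight n (snd w))"
  by (intro hypercontractive_tensor elem_two_group_xor hypercontractive_xor bit_weight_nonneg)

lemma pauli_norm_square:
  assumes "A \<in> carrier_mat (2 ^ n) (2 ^ n)"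
  shows "Re (ntr (mat_adjoint A * A)) = (\<Sum>w\<in>pauli_words n. (cmod (pauli_coeff n A w))\<^sup>2)"
proof -
  have "cnj z * z = of_real ((cmod z)\<^sup>2)" for z
    by (subst complex_norm_square) (simp add: mult.commute)
  thus ?thesis
    unfolding pauli_parseval[OF assms assms] by (simp del: of_real_power)
qed

text \<open>
  Hypercontractivity for matrices: damping every coefficient by \<open>1 / 4\<close> per qubit of
  its support makes the \<open>L\<^sub>4\<close> norm at most the \<open>L\<^sub>2\<close> norm of
  the undamped coefficients \<open>b\<close>.
\<close>

lemma noisy_fourth_moment:
  assumes h: "h \<in> carrier_mat (2 ^ n) (2 ^ n)"
    and b: "\<And>w. w \<in> pauli_words n \<Longrightarrow> 0 \<le> b w"
    and hb: "\<And>w. w \<in> pauli_words n \<Longrightarrow> cmod (pauli_coeff n h w) = (1 / 4) ^ supp_size n w * b w"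
  shows "Re (ntr (mat_adjoint (mat_adjoint h * h) * (mat_adjoint h * h))) \<le>
    (\<Sum>w\<in>pauli_words n. (b w)\<^sup>2)\<^sup>2"
proof -
  let ?W = "pauli_words n"
  let ?c = "\<lambda>w. cmod (pauli_coeff n h w)"
  let ?a = "\<lambda>w. bit_weight n (fst w) * bit_weight n (snd w) * b w"
  have hh: "mat_adjoint h * h \<in> carrier_mat (2 ^ n) (2 ^ n)"
    by (rule mult_carrier_mat[OF mat_adjoint_carrier[OF h] h])
  have ca: "?c w \<le> ?a w" if "w \<in> ?W" for w
    unfolding hb[OF that] by (rule mult_right_mono[OF supp_size_weight b[OF that]])
  have "Re (ntr (mat_adjoint (mat_adjoint h * h) * (mat_adjoint h * h))) =
    (\<Sum>w\<in>?W. (cmod (pauli_coeff n (mat_adjoint h * h) w))\<^sup>2)"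
    by (rule pauli_norm_square[OF hh])
  also have "\<dots> \<le> (\<Sum>w\<in>?W. (xcorr ?W pauli_mult ?a ?a w)\<^sup>2)"
  proof (intro sum_mono power_mono)
    fix w assume w: "w \<in> ?W"
    have "cmod (pauli_coeff n (mat_adjoint h * h) w) \<le> xcorr ?W pauli_mult ?c ?c w"
      by (rule pauli_coeff_adjoint_mult[OF h h w])
    also have "\<dots> \<le> xcorr ?W pauli_mult ?a ?a w"
      unfolding xcorr_def
    proof (intro sum_mono mult_mono)
      fix v assume v: "v \<in> ?W"
      have vw: "pauli_mult v w \<in> ?W" using v w by (auto simp: pair_op_def xor_less_two_power)
      show "?c v \<le> ?a v" by (rule ca[OF v])
      show "?c (pauli_mult v w) \<le> ?a (pauli_mult v w)" by (rule ca[OF vw])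
      show "0 \<le> ?a v" by (rule order_trans[OF norm_ge_zero ca[OF v]])
    qed simp
    finally show "cmod (pauli_coeff n (mat_adjoint h * h) w) \<le> xcorr ?W pauli_mult ?a ?a w" .
  qed simp
  also have "\<dots> \<le> (\<Sum>w\<in>?W. (b w)\<^sup>2)\<^sup>2"
    by (rule hypercontractiveD[OF hypercontractive_pauli b])
  finally show ?thesis .
qed

text \<open>
  The factor \<open>1 / 16\<close> is the square of the damping \<open>1 / 4\<close>. With
  \<open>S\<close> for the left-hand side and \<open>h\<close> for the matrix \<open>f\<close>
  damped twice, duality gives \<open>S\<^sup>4 \<le> \<parallel>f\<parallel>\<^sub>1\<^sup>2
  \<parallel>f\<parallel>\<^sub>2\<^sup>2 tr((h\<^sup>* h)\<^sup>2)\<close>, while the last factor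
  is at most \<open>S\<^sup>2\<close>: \<open>h\<close> is \<open>f\<close> damped once and then
  once more, and the squared norm of \<open>f\<close> damped once is \<open>S\<close>.
\<close>

lemma noise_stability_bound:
  assumes f: "f \<in> carrier_mat (2 ^ n) (2 ^ n)" "mat_adjoint f = f"
  shows "(\<Sum>w\<in>pauli_words n. (1 / 16) ^ supp_size n w * (cmod (pauli_coeff n f w))\<^sup>2) \<le>
    lp_norm 1 f * lp_norm 2 f"
proof -
  let ?W = "pauli_words n"
  let ?S = "\<Sum>w\<in>?W. (1 / 16) ^ supp_size n w * (cmod (pauli_coeff n f w))\<^sup>2"
  obtain h where h: "h \<in> carrier_mat (2 ^ n) (2 ^ n)"
    and hc: "\<And>w. w \<in> ?W \<Longrightarrow> pauli_coeff n h w = of_real ((1 / 16) ^ supp_size n w) * pauli_coeff n f w"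
    using pauli_synthesis[of n "\<lambda>w. of_real ((1 / 16) ^ supp_size n w) * pauli_coeff n f w"] by blast
  have cc: "cnj z * (of_real c * z) = of_real (c * (cmod z)\<^sup>2)" for z c
    unfolding of_real_mult complex_norm_square by (simp add: mult_ac)
  have "ntr (mat_adjoint f * h) = of_real ?S"
    unfolding pauli_parseval[OF f(1) h] of_real_sum
    by (intro sum.cong refl) (simp only: hc cc)
  moreover have S0: "?S \<ge> 0" by (intro sum_nonneg) auto
  ultimately have norm_S: "cmod (ntr (mat_adjoint f * h)) = ?S" by (simp only: norm_of_real abs_of_nonneg)
  let ?b = "\<lambda>w. (1 / 4) ^ supp_size n w * cmod (pauli_coeff n f w)"
  have e: "(1 / 16 :: real) ^ m = (1 / 4) ^ m * (1 / 4) ^ m" for m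
    by (simp flip: power_mult_distrib)
  have "Re (ntr (mat_adjoint (mat_adjoint h * h) * (mat_adjoint h * h))) \<le> (\<Sum>w\<in>?W. (?b w)\<^sup>2)\<^sup>2"
  proof (rule noisy_fourth_moment[OF h])
    fix w assume "w \<in> ?W"
    thus "cmod (pauli_coeff n h w) = (1 / 4) ^ supp_size n w * ?b w"
      unfolding hc[OF \<open>w \<in> ?W\<close>] norm_mult norm_of_real e by simp
  qed simp
  also have "(\<Sum>w\<in>?W. (?b w)\<^sup>2) = ?S"
    unfolding e by (simp add: power2_eq_square mult_ac)
  finally have h4: "Re (ntr (mat_adjoint (mat_adjoint h * h) * (mat_adjoint h * h))) \<le> ?S\<^sup>2" .
  have "(?S\<^sup>2)\<^sup>2 \<le> (lp_norm 1 f)\<^sup>2 * (lp_norm 2 f)\<^sup>2 *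
      Re (ntr (mat_adjoint (mat_adjoint h * h) * (mat_adjoint h * h)))"
    using trace_duality[OF f h] unfolding norm_S .
  also have "\<dots> \<le> (lp_norm 1 f)\<^sup>2 * (lp_norm 2 f)\<^sup>2 * ?S\<^sup>2"
    by (rule mult_left_mono[OF h4]) simp
  finally have *: "?S\<^sup>2 * ?S\<^sup>2 \<le> (lp_norm 1 f * lp_norm 2 f)\<^sup>2 * ?S\<^sup>2"
    unfolding power_mult_distrib[of "lp_norm 1 f"] power2_eq_square[of "?S\<^sup>2"] .
  show ?thesis
  proof (cases "?S = 0")
    case True
    thus ?thesis using lp_norm_nonneg by simp
  next
    case False
    hence "?S\<^sup>2 > 0" by simp
    hence "?S\<^sup>2 \<le> (lp_norm 1 f * lp_norm 2 f)\<^sup>2"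
      using * by (simp only: mult_le_cancel_right_pos)
    thus ?thesis by (rule power2_le_imp_le) (simp add: lp_norm_nonneg)
  qed
qed


section \<open>From noise stability to a large influence\<close>

text \<open>
  The average of \<open>D\<close> with respect to the weights is at most \<open>4 L\<close>, so by
  Markov's inequality half of the mass has \<open>D \<le> 8 L\<close>. The proof uses the
  pointwise form of this, namely \<open>16\<^bsup>-8 L\<^esup> (1 - D / (8 L)) \<le> D
  16\<^bsup>-D\<^esup>\<close>, whose left-hand side is negative for larger \<open>D\<close>.
\<close>

lemma low_degree_mass:
  fixes p :: "'a \<Rightarrow> real" and D :: "'a \<Rightarrow> nat"
  assumes p: "\<And>w. w \<in> W \<Longrightarrow> 0 \<le> p w" and D: "\<And>w. w \<in> W \<Longrightarrow> 1 \<le> D w"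
    and mass: "(\<Sum>w\<in>W. p w) = 1 / 4" and L: "(\<Sum>w\<in>W. D w * p w) \<le> L"
  shows "1 / 4 \<le> L"
    and "16 powr (- 8 * L) / 8 \<le> (\<Sum>w\<in>W. D w * ((1 / 16) ^ D w * p w))"
proof -
  have "(\<Sum>w\<in>W. p w) \<le> (\<Sum>w\<in>W. D w * p w)"
  proof (rule sum_mono)
    fix w assume w: "w \<in> W"
    have "1 * p w \<le> D w * p w" using p[OF w] D[OF w] by (intro mult_right_mono) auto
    thus "p w \<le> D w * p w" by simp
  qed
  thus L4: "1 / 4 \<le> L" using mass L by linarith
  have "16 powr (- 8 * L) / 8 \<le> 16 powr (- 8 * L) * (1 / 4 - (\<Sum>w\<in>W. D w * p w) / (8 * L))"
  proof -
    have "(\<Sum>w\<in>W. D w * p w) / (8 * L) \<le> 1 / 8"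
      using L L4 by (simp add: divide_simps)
    thus ?thesis by simp
  qed
  also have "\<dots> = (\<Sum>w\<in>W. 16 powr (- 8 * L) * (p w * (1 - D w / (8 * L))))"
    unfolding mass[symmetric] sum_divide_distrib sum_subtractf[symmetric] sum_distrib_left
    by (intro sum.cong refl) (simp add: algebra_simps)
  also have "\<dots> \<le> (\<Sum>w\<in>W. D w * ((1 / 16) ^ D w * p w))"
  proof (rule sum_mono)
    fix w assume w: "w \<in> W"
    show "16 powr (- 8 * L) * (p w * (1 - D w / (8 * L))) \<le> D w * ((1 / 16) ^ D w * p w)"
    proof (cases "D w \<le> 8 * L")
      case True
      have "16 powr (- 8 * L) * (p w * (1 - D w / (8 * L))) \<le> 16 powr (- 8 * L) * (p w * 1)"
        using p[OF w] L4 by (intro mult_left_mono) auto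
      also have "16 powr (- 8 * L) \<le> 16 powr (- real (D w))"
        using True by (intro powr_mono) auto
      hence "16 powr (- 8 * L) * (p w * 1) \<le> 16 powr (- real (D w)) * (p w * 1)"
        using p[OF w] by (intro mult_right_mono) auto
      also have "16 powr (- real (D w)) = (1 / 16) ^ D w"
        by (simp add: powr_minus powr_realpow power_one_over inverse_eq_divide)
      also have "(1 / 16) ^ D w * (p w * 1) \<le> D w * ((1 / 16) ^ D w * p w)"
      proof -
        have "1 * ((1 / 16) ^ D w * p w) \<le> D w * ((1 / 16) ^ D w * p w)"
          using p[OF w] D[OF w] by (intro mult_right_mono) auto
        thus ?thesis by simp
      qed
      finally show ?thesis .
    next
      case False
      hence "1 - D w / (8 * L) \<le> 0" using L4 by (simp add: divide_simps)
      hence "16 powr (- 8 * L) * (p w * (1 - D w / (8 * L))) \<le> 0"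
        using p[OF w] by (intro mult_nonneg_nonpos) auto
      also have "0 \<le> D w * ((1 / 16) ^ D w * p w)" using p[OF w] by simp
      finally show ?thesis .
    qed
  qed
  finally show "16 powr (- 8 * L) / 8 \<le> (\<Sum>w\<in>W. D w * ((1 / 16) ^ D w * p w))" .
qed

text \<open>
  Take logarithms, with \<open>L = n M\<close>: the term \<open>\<delta> ln n\<close> is bounded
  by terms that are at most linear in \<open>L\<close>, where the constant \<open>ln 8\<close> is
  absorbed by means of \<open>1 \<le> 4 L\<close>.
\<close>

lemma log_lower_bound:
  fixes n :: nat and M \<delta> :: real
  assumes n: "n \<ge> 1" and \<delta>: "\<delta> > 0" and M: "1 / 4 \<le> n * M"
    and le: "16 powr (- 8 * (n * M)) / 8 \<le> n * M powr (1 + \<delta>)"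
  shows "\<delta> / (1 + \<delta> + 8 * ln 16 + 4 * ln 8) * ln n / n \<le> M"
proof -
  define L where "L = n * M"
  have n0: "real n > 0" using n by simp
  have L: "L \<ge> 1 / 4" using M by (simp add: L_def)
  have M0: "M > 0" using M n0 by (smt (verit) divide_pos_pos mult_nonneg_nonpos)
  have "ln (16 powr (- 8 * L) / 8) \<le> ln (n * M powr (1 + \<delta>))"
    using le n0 M0 by (subst ln_le_cancel_iff) (auto simp: L_def)
  moreover have "ln (16 powr (- 8 * L) / 8) = - 8 * L * ln 16 - ln 8"
    by (simp add: ln_div ln_powr)
  moreover have "ln (n * M powr (1 + \<delta>)) = ln n + (1 + \<delta>) * ln M"
    using n0 M0 by (simp add: ln_mult ln_powr)
  moreover have "ln M = ln L - ln n"
    using n0 M0 by (simp add: L_def ln_mult)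
  ultimately have "\<delta> * ln n \<le> (1 + \<delta>) * ln L + 8 * (L * ln 16) + ln 8"
    by (simp add: algebra_simps)
  also have "(1 + \<delta>) * ln L \<le> (1 + \<delta>) * L"
    using \<delta> L ln_le_minus_one[of L] by (intro mult_left_mono) auto
  also have "ln 8 \<le> ln 8 * (4 * L)"
    using mult_left_mono[of 1 "4 * L" "ln 8 :: real"] L by simp
  finally have "\<delta> * ln n \<le> (1 + \<delta> + 8 * ln 16 + 4 * ln 8) * L"
    by (simp add: algebra_simps)
  moreover have "1 + \<delta> + 8 * ln 16 + 4 * ln 8 > (0::real)"
    using \<delta> by (intro add_pos_pos) auto
  ultimately have "\<delta> / (1 + \<delta> + 8 * ln 16 + 4 * ln 8) * ln n \<le> L"
    by (simp add: pos_divide_le_eq mult.commute)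
  thus ?thesis
    unfolding L_def by (subst pos_divide_le_eq[OF n0]) (simp add: mult.commute)
qed

lemma influence_pauli:
  assumes T: "T \<in> carrier_mat (2 ^ n) (2 ^ n)" "mat_adjoint T = T" and j: "j \<in> {1..n}"
  shows "(lp_norm 2 (partial_deriv n j T))\<^sup>2 =
    (\<Sum>w\<in>pauli_words n. of_bool (in_support w (n - j)) * (cmod (pauli_coeff n T w))\<^sup>2)"
  unfolding lp_norm_two_hermitian[OF partial_deriv_carrier[OF T(1)] partial_deriv_hermitian[OF T j]]
    pauli_norm_square[OF partial_deriv_carrier[OF T(1)]]
  by (intro sum.cong refl) (simp add: pauli_coeff_partial_deriv[OF T(1) j])

text \<open>
  The exponent 2 is always admissible because the \<open>L\<^sub>1\<close> norm is at most the
  \<open>L\<^sub>2\<close> norm. So the infimum is over a nonempty set, and every bound above the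
  index is beaten by an admissible exponent.
\<close>

lemma index_exponent:
  assumes T: "T \<in> carrier_mat (2 ^ n) (2 ^ n)" "mat_adjoint T = T" and ind: "ind n T < \<beta>"
  obtains \<alpha> where "0 \<le> \<alpha>" "\<alpha> < \<beta>"
    "\<And>j. j \<in> {1..n} \<Longrightarrow> lp_norm 1 (partial_deriv n j T) powr \<alpha> \<le> (lp_norm 2 (partial_deriv n j T))\<^sup>2"
proof -
  let ?S = "{\<alpha>. 0 \<le> \<alpha> \<and> (\<forall>j\<in>{1..n}.
     lp_norm 1 (partial_deriv n j T) powr \<alpha> \<le> (lp_norm 2 (partial_deriv n j T))\<^sup>2)}"
  have "2 \<in> ?S"
    using lp_norm_one_le_two[OF partial_deriv_carrier[OF T(1)] partial_deriv_hermitian[OF T]]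
    by (simp add: powr_numeral lp_norm_nonneg)
  hence "?S \<noteq> {}" by blast
  from cInf_lessD[OF this] ind obtain \<alpha> where "\<alpha> \<in> ?S" "\<alpha> < \<beta>"
    unfolding ind_def by blast
  thus ?thesis using that by blast
qed

text \<open>
  All derivatives have \<open>L\<^sub>1\<close> norm at most 1, so the exponent
  \<open>\<alpha>\<close> may be replaced by the larger \<open>\<beta>\<close>, and the resulting
  constant depends on \<open>\<beta>\<close> only.
\<close>

lemma max_influence_bound:
  fixes \<alpha> \<beta> :: real
  assumes n: "n \<ge> 1" and T: "T \<in> carrier_mat (2 ^ n) (2 ^ n)" "balanced_projection T"
    and \<alpha>: "\<alpha> \<le> \<beta>" and \<beta>: "0 < \<beta>" "\<beta> < 2"
    and idx: "\<And>j. j \<in> {1..n} \<Longrightarrow> lp_norm 1 (partial_deriv n j T) powr \<alpha> \<le> (lp_norm 2 (partial_deriv n j T))\<^sup>2"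
    and M: "\<And>j. j \<in> {1..n} \<Longrightarrow> (lp_norm 2 (partial_deriv n j T))\<^sup>2 \<le> M"
  defines "\<delta> \<equiv> 1 / \<beta> - 1 / 2"
  shows "\<delta> / (1 + \<delta> + 8 * ln 16 + 4 * ln 8) * ln n / n \<le> M"
proof -
  let ?W = "pauli_words n" and ?W' = "pauli_words n - {(0, 0)}"
  define p where "p w = (cmod (pauli_coeff n T w))\<^sup>2" for w
  define I where "I j = (lp_norm 2 (partial_deriv n j T))\<^sup>2" for j
  have H: "mat_adjoint T = T" and TT: "T * T = T"
    using T(2) by (auto simp: balanced_projection_def projection_def)
  have p0: "p w \<ge> 0" for w by (simp add: p_def)
  have fin: "finite ?W" by simp
  have 00: "(0, 0) \<in> ?W" by simp
  have I_eq: "I j = (\<Sum>w\<in>?W. of_bool (in_support w (n - j)) * p w)" if "j \<in> {1..n}" for j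
    unfolding I_def p_def by (rule influence_pauli[OF T(1) H that])
  have mass: "(\<Sum>w\<in>?W'. p w) = 1 / 4"
  proof -
    have "mat_abs T * mat_abs T = mat_adjoint T * T"
      using mat_abs_square[OF T(1) H] by (simp add: H)
    hence "variance T = (\<Sum>w\<in>?W. p w) - p (0, 0)"
      using pauli_norm_square[OF T(1)] ntr_pauli_coeff[OF T(1)]
      by (simp add: variance_def p_def)
    also have "\<dots> = (\<Sum>w\<in>?W'. p w)"
      using sum.remove[OF fin 00, of p] by simp
    finally show ?thesis using T(2) by (simp add: balanced_projection_def)
  qed
  have supp0: "\<not> in_support (0, 0) k" "supp_size n (0, 0) = 0" for k
    by (simp_all add: in_support_def supp_size_def)
  have I_le: "I j \<le> 1" if "j \<in> {1..n}" for j
  proof -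
    have "I j = (\<Sum>w\<in>?W'. of_bool (in_support w (n - j)) * p w)"
      unfolding I_eq[OF that]
      using sum.remove[OF fin 00, of "\<lambda>w. of_bool (in_support w (n - j)) * p w"]
      by (simp only: supp0 of_bool_eq mult_zero_left add_0)
    also have "\<dots> \<le> (\<Sum>w\<in>?W'. p w)"
      by (intro sum_mono) (simp add: p0)
    finally show ?thesis using mass by simp
  qed
  \<comment> \<open>count every word once for each qubit in its support; \<open>c = 1\<close> gives the total influence\<close>
  have deg: "(\<Sum>w\<in>?W'. supp_size n w * (c w * p w)) =
     (\<Sum>j\<in>{1..n}. \<Sum>w\<in>?W. of_bool (in_support w (n - j)) * (c w * p w))" for c
  proof -
    have "(\<Sum>w\<in>?W'. supp_size n w * (c w * p w)) = (\<Sum>w\<in>?W. supp_size n w * (c w * p w))"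
      using sum.remove[OF fin 00, of "\<lambda>w. supp_size n w * (c w * p w)"] by (simp add: supp0)
    also have "\<dots> = (\<Sum>w\<in>?W. \<Sum>j\<in>{1..n}. of_bool (in_support w (n - j)) * (c w * p w))"
      by (simp add: supp_size_sum sum_distrib_right)
    finally show ?thesis by (subst (asm) sum.swap)
  qed
  have total: "(\<Sum>w\<in>?W'. supp_size n w * p w) \<le> n * M"
  proof -
    have "(\<Sum>w\<in>?W'. supp_size n w * p w) = (\<Sum>j\<in>{1..n}. I j)"
      using deg[of "\<lambda>_. 1"] I_eq by simp
    also have "\<dots> \<le> (\<Sum>j\<in>{1..n}. M)" using M unfolding I_def by (intro sum_mono) auto
    finally show ?thesis by simp
  qed
  have noisy: "(\<Sum>w\<in>?W. of_bool (in_support w (n - j)) * ((1 / 16) ^ supp_size n w * p w)) \<le> M powr (1 + \<delta>)"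
    if j: "j \<in> {1..n}" for j
  proof -
    let ?f = "partial_deriv n j T"
    let ?a = "lp_norm 1 ?f"
    note f = partial_deriv_carrier[OF T(1), of j] and fH = partial_deriv_hermitian[OF T(1) H j]
    have a0: "?a \<ge> 0" by (rule lp_norm_nonneg)
    have I0: "I j \<ge> 0" by (simp add: I_def)
    have "?a\<^sup>2 \<le> 1\<^sup>2"
      using lp_norm_one_le_two[OF f fH] I_le[OF j] by (simp add: I_def)
    hence a1: "?a \<le> 1" by (rule power2_le_imp_le) simp
    have "?a powr \<beta> \<le> ?a powr \<alpha>"
    proof (cases "?a = 0")
      case False
      thus ?thesis using a0 a1 \<alpha> by (intro powr_mono') auto
    qed simp
    also have "\<dots> \<le> I j" unfolding I_def by (rule idx[OF j])
    finally have "(?a powr \<beta>) powr (1 / \<beta>) \<le> I j powr (1 / \<beta>)"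
      using \<beta> by (intro powr_mono2) auto
    hence a: "?a \<le> I j powr (1 / \<beta>)" using a0 \<beta> by (simp add: powr_powr)
    have b: "lp_norm 2 ?f = I j powr (1 / 2)"
      by (simp add: I_def powr_half_sqrt lp_norm_nonneg)
    have "(\<Sum>w\<in>?W. of_bool (in_support w (n - j)) * ((1 / 16) ^ supp_size n w * p w)) =
      (\<Sum>w\<in>?W. (1 / 16) ^ supp_size n w * (cmod (pauli_coeff n ?f w))\<^sup>2)"
      by (intro sum.cong refl) (simp add: pauli_coeff_partial_deriv[OF T(1) j] p_def)
    also have "\<dots> \<le> ?a * lp_norm 2 ?f" by (rule noise_stability_bound[OF f fH])
    also have "\<dots> \<le> I j powr (1 / \<beta>) * I j powr (1 / 2)"
      unfolding b by (rule mult_right_mono[OF a]) simp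
    also have "\<dots> = I j powr (1 + \<delta>)"
      by (simp add: \<delta>_def add.commute flip: powr_add)
    also have "\<dots> \<le> M powr (1 + \<delta>)"
      using M[OF j] I0 \<beta> by (intro powr_mono2) (auto simp: I_def \<delta>_def)
    finally show ?thesis .
  qed
  have low: "1 / 4 \<le> n * M" and
    "16 powr (- 8 * (n * M)) / 8 \<le> (\<Sum>w\<in>?W'. supp_size n w * ((1 / 16) ^ supp_size n w * p w))"
    using low_degree_mass[OF p0 _ mass total] supp_size_pos by auto
  note this(2)
  also have "(\<Sum>w\<in>?W'. supp_size n w * ((1 / 16) ^ supp_size n w * p w)) \<le> (\<Sum>j\<in>{1..n}. M powr (1 + \<delta>))"
    unfolding deg by (intro sum_mono noisy)
  finally have "16 powr (- 8 * (n * M)) / 8 \<le> n * M powr (1 + \<delta>)" by simp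
  moreover have "\<delta> > 0" using \<beta> by (simp add: \<delta>_def divide_simps)
  ultimately show ?thesis using log_lower_bound[OF n _ low] by blast
qed

theorem theorem5p14:
  shows "\<forall>\<iota>::real. \<iota> < 2 \<longrightarrow>
    (\<exists>C::real. C > 0 \<and>
      (\<forall>n::nat. n \<ge> 1 \<longrightarrow>
        (\<forall>T \<in> carrier_mat (2 ^ n) (2 ^ n).
          balanced_projection T \<and> ind n T = \<iota> \<longrightarrow>
          Max ((\<lambda>j. (lp_norm 2 (partial_deriv n j T))\<^sup>2) ` {1..n}) \<ge> C * ln (real n) / real n)))"
proof (intro allI impI)
  fix \<iota> :: real assume \<iota>: "\<iota> < 2"
  \<comment> \<open>strictly between \<open>\<iota>\<close> and 2, and positive also if \<open>\<iota>\<close> is not\<close>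
  define \<beta> where "\<beta> = max 1 ((\<iota> + 2) / 2)"
  define \<delta> where "\<delta> = 1 / \<beta> - 1 / 2"
  have \<beta>: "\<iota> < \<beta>" "0 < \<beta>" "\<beta> < 2" using \<iota> by (auto simp: \<beta>_def max_def)
  have "\<delta> > 0" using \<beta> by (simp add: \<delta>_def divide_simps)
  hence C: "\<delta> / (1 + \<delta> + 8 * ln 16 + 4 * ln 8) > 0"
    by (intro divide_pos_pos add_pos_pos) auto
  show "\<exists>C::real. C > 0 \<and>
      (\<forall>n::nat. n \<ge> 1 \<longrightarrow>
        (\<forall>T \<in> carrier_mat (2 ^ n) (2 ^ n).
          balanced_projection T \<and> ind n T = \<iota> \<longrightarrow>
          Max ((\<lambda>j. (lp_norm 2 (partial_deriv n j T))\<^sup>2) ` {1..n}) \<ge> C * ln (real n) / real n))"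
  proof (intro exI conjI allI impI ballI, rule C)
    fix n :: nat and T assume n: "1 \<le> n" and T: "T \<in> carrier_mat (2 ^ n) (2 ^ n)"
      and "balanced_projection T \<and> ind n T = \<iota>"
    hence bal: "balanced_projection T" and ind: "ind n T < \<beta>" using \<beta>(1) by auto
    have H: "mat_adjoint T = T" using bal by (simp add: balanced_projection_def projection_def)
    obtain \<alpha> where "\<alpha> < \<beta>"
      "\<And>j. j \<in> {1..n} \<Longrightarrow> lp_norm 1 (partial_deriv n j T) powr \<alpha> \<le> (lp_norm 2 (partial_deriv n j T))\<^sup>2"
      using index_exponent[OF T H ind] by blast
    thus "\<delta> / (1 + \<delta> + 8 * ln 16 + 4 * ln 8) * ln (real n) / real n \<le>
        Max ((\<lambda>j. (lp_norm 2 (partial_deriv n j T))\<^sup>2) ` {1..n})"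
      unfolding \<delta>_def using n T bal \<beta>(2,3)
      by (intro max_influence_bound[where \<alpha> = \<alpha>]) auto
  qed
qed

end
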